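(* For each positive integer $n$ there is a constant $R_n$, depending only on $n$, such that the following holds. If $\Sigma^n \subset \mathbf{R}^{n+1}$ is a properly embedded shrinker and $R \geq R_n$ is such that $\partial \Sigma \subset \partial B_R$ and $B_R \cap \Sigma \neq \emptyset$, then $B_{R_n} \cap \Sigma$ intersects every generalized cylinder $\mathbf{S}^k_{\sqrt{2k}} \times \mathbf{R}^{n-k}$ for $k = 0, 1, \dots, n$.
   Context: $B_r$ denotes the open Euclidean ball of radius $r$ centered at the origin. A shrinker is a (smooth) $n$-dimensional submanifold $\Sigma^n \subset \mathbf{R}^{N}$, possibly with boundary, satisfying the shrinker equation $\mathbf{H} = \frac{1}{2} x^{\perp}$, where $x$ is the position vector, $x^\perp$ is its component normal to $\Sigma$, and $\mathbf{H}$ is the mean curvature vector with the sign convention $\mathbf{H} = -\sum_i A(f_i,f_i)$ ($A$ the vector-valued second fundamental form $A(X,Y) = (D_X Y)^\perp$, $D$ the Euclidean derivative, $f_i$ an orthonormal tangent frame). Equivalently, $\Sigma$ is a critical point of the Gaussian area $F(\Sigma) = (4\pi)^{-n/2}\int_\Sigma e^{-|x|^2/4}$. Generalized cylinders: $\mathbf{S}^k_{\sqrt{2k}} \times \mathbf{R}^{n-k} \subset \mathbf{R}^{n+1}$, where the $k$-sphere is centered at $0$ with radius $\sqrt{2k}$ in a $(k+1)$-dimensional linear subspace and $\mathbf{R}^{n-k}$ is the orthogonal complementary linear subspace (containing $0$). All rotations about the origin are allowed. The case $k=0$ means a hyperplane through the origin, and $k=n$ means the $n$-sphere of radius $\sqrt{2n}$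 centered at the origin. All of these are shrinkers. *)

theory Defs
  imports "HOL-Analysis.Analysis"
begin

section \<open>Smooth maps on open sets\<close>

primrec Ck_on :: "nat \<Rightarrow> 'a::euclidean_space set \<Rightarrow> ('a \<Rightarrow> 'b::euclidean_space) \<Rightarrow> bool" where
  "Ck_on 0 U f \<longleftrightarrow> continuous_on U f"
| "Ck_on (Suc k) U f \<longleftrightarrow>
     (\<forall>x\<in>U. f differentiable (at x)) \<and>
     (\<forall>v. Ck_on k U (\<lambda>x. frechet_derivative f (at x) v))"

definition smooth_on :: "'a::euclidean_space set \<Rightarrow> ('a \<Rightarrow> 'b::euclidean_space) \<Rightarrow> bool" where
  "smooth_on U f \<longleftrightarrow> open U \<and> (\<forall>k. Ck_on k U f)"

definition diffeomorphism ::
    "'a::euclidean_space set \<Rightarrow> 'b::euclidean_space set \<Rightarrow> ('a \<Rightarrow> 'b) \<Rightarrow> ('b \<Rightarrow> 'a) \<Rightarrow> bool" where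
  "diffeomorphism U V \<phi> \<psi> \<longleftrightarrow> homeomorphism U V \<phi> \<psi> \<and> smooth_on U \<phi> \<and> smooth_on V \<psi>"

section \<open>Embedded submanifolds with boundary\<close>

text \<open>Slice charts of the ambient space, with an arbitrary \<open>n\<close>-dimensional subspace \<open>L\<close> as the model;
  at boundary points the model is the closed half of \<open>L\<close> with inward normal \<open>e\<close>, and the point
  itself is sent to the bounding hyperplane.\<close>

definition interior_point :: "nat \<Rightarrow> 'a::euclidean_space set \<Rightarrow> 'a \<Rightarrow> bool" where
  "interior_point n S p \<longleftrightarrow>
     (\<exists>U V L \<psi> \<phi>. p \<in> U \<and> diffeomorphism U V \<phi> \<psi> \<and> subspace L \<and> dim L = n \<and>
        \<phi> ` (U \<inter> S) = V \<inter> (L :: 'a set))"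

definition boundary_point :: "nat \<Rightarrow> 'a::euclidean_space set \<Rightarrow> 'a \<Rightarrow> bool" where
  "boundary_point n S p \<longleftrightarrow>
     (\<exists>U V L e \<psi> \<phi>. p \<in> U \<and> diffeomorphism U V \<phi> \<psi> \<and> subspace L \<and> dim L = n \<and>
        e \<in> L \<and> e \<noteq> 0 \<and> \<phi> ` (U \<inter> S) = V \<inter> {y \<in> (L :: 'a set). 0 \<le> y \<bullet> e} \<and> \<phi> p \<bullet> e = 0)"

definition submanifold_with_boundary :: "nat \<Rightarrow> 'a::euclidean_space set \<Rightarrow> bool" where
  "submanifold_with_boundary n S \<longleftrightarrow> (\<forall>p\<in>S. interior_point n S p \<or> boundary_point n S p)"

definition manifold_boundary :: "nat \<Rightarrow> 'a::euclidean_space set \<Rightarrow> 'a set" where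
  "manifold_boundary n S = {p \<in> S. boundary_point n S p}"

definition properly_embedded :: "nat \<Rightarrow> 'a::euclidean_space set \<Rightarrow> bool" where
  "properly_embedded n S \<longleftrightarrow>
     submanifold_with_boundary n S \<and> proper_map (top_of_set S) euclidean (\<lambda>x. x)"

section \<open>Extrinsic geometry and shrinkers\<close>

text \<open>At a boundary point the velocities of curves that start at \<open>p\<close> and stay in \<open>S\<close> only fill
  a closed half of the \<open>n\<close>-dimensional tangent space, hence the span.\<close>

definition tangent_space :: "'a::euclidean_space set \<Rightarrow> 'a \<Rightarrow> 'a set" where
  "tangent_space S p = span {v. \<exists>\<gamma> \<epsilon>. 0 < \<epsilon> \<and> \<gamma> 0 = p \<and> \<gamma> ` {0..<\<epsilon>} \<subseteq> S \<and>
     (\<gamma> has_vector_derivative v) (at (0::real) within {0..<\<epsilon>})}"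

definition normal_part :: "'a::euclidean_space set \<Rightarrow> 'a \<Rightarrow> 'a \<Rightarrow> 'a" where
  "normal_part S p v =
     (THE w. w \<in> orthogonal_comp (tangent_space S p) \<and> v - w \<in> tangent_space S p)"

text \<open>\<open>A(X,Y) = (D\<^sub>X Y)\<^sup>\<bottom>\<close>. The fields are given on an ambient neighbourhood; for \<open>X\<close>, \<open>Y\<close>
  tangent to \<open>S\<close> along \<open>S\<close> the value at \<open>p \<in> S\<close> depends only on \<open>X p\<close> and \<open>Y p\<close>.\<close>

definition second_fundamental_form ::
    "'a::euclidean_space set \<Rightarrow> ('a \<Rightarrow> 'a) \<Rightarrow> ('a \<Rightarrow> 'a) \<Rightarrow> 'a \<Rightarrow> 'a" where
  "second_fundamental_form S X Y p = normal_part S p (frechet_derivative Y (at p) (X p))"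

definition orthonormal_tangent_frame ::
    "nat \<Rightarrow> 'a::euclidean_space set \<Rightarrow> 'a set \<Rightarrow> (nat \<Rightarrow> 'a \<Rightarrow> 'a) \<Rightarrow> bool" where
  "orthonormal_tangent_frame n S U f \<longleftrightarrow>
     (\<forall>i<n. smooth_on U (f i)) \<and>
     (\<forall>q\<in>U \<inter> S. \<forall>i<n. f i q \<in> tangent_space S q \<and>
        (\<forall>j<n. f i q \<bullet> f j q = (if i = j then 1 else 0)))"

text \<open>A local frame exists near every point of a submanifold, and the sum below does not depend
  on the choice of frame.\<close>

definition mean_curvature :: "nat \<Rightarrow> 'a::euclidean_space set \<Rightarrow> 'a \<Rightarrow> 'a" where
  "mean_curvature n S p = (THE h. \<exists>U f. open U \<and> p \<in> U \<and> orthonormal_tangent_frame n S U f \<and>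
     h = - (\<Sum>i<n. second_fundamental_form S (f i) (f i) p))"

definition shrinker :: "nat \<Rightarrow> 'a::euclidean_space set \<Rightarrow> bool" where
  "shrinker n S \<longleftrightarrow> submanifold_with_boundary n S \<and>
     (\<forall>x\<in>S. mean_curvature n S x = (1/2) *\<^sub>R normal_part S x x)"

section \<open>Generalized cylinders\<close>

text \<open>\<open>W\<close> is the linear subspace of dimension \<open>k + 1\<close> that contains the spherical factor; letting it
  vary accounts for the rotations about the origin.\<close>

definition generalized_cylinder :: "nat \<Rightarrow> 'a::euclidean_space set \<Rightarrow> 'a set" where
  "generalized_cylinder k W =
     {y + z | y z. y \<in> W \<and> norm y = sqrt (2 * real k) \<and> z \<in> orthogonal_comp W}"

end

theory Submission
  imports Defs
begin

text \<open>Only the maximum principle is used. Let \<open>L\<close> be the drift Laplacian of the shrinker, that is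
  \<open>\<Delta>\<close> minus the derivative along the tangential part of \<open>x/2\<close>, and \<open>\<rho> = |P x|\<close> with \<open>P\<close> the
  orthogonal projection onto \<open>W\<close>, so that the cylinder is
  \<open>\<rho> = sqrt (2 k)\<close>. Since \<open>L |x|\<^sup>2 = 2 n - |x|\<^sup>2\<close>, a point of least norm lies in the ball of radius
  \<open>sqrt (2 n)\<close>. Where \<open>\<rho> > sqrt (2 k)\<close> the function \<open>u = \<rho> - sqrt (2 k)\<close> satisfies \<open>L u \<le> - u / 2\<close>, and
  where \<open>\<rho> < sqrt (2 k)\<close> the function \<open>u = 2 k - \<rho>\<^sup>2\<close> satisfies \<open>L u \<le> - u\<close>. For \<open>a\<^sup>2 > 4 n\<close> the function
  \<open>w = a\<^sup>2 - |x|\<^sup>2\<close> satisfies \<open>L w > - w / 2\<close> and vanishes on the sphere of radius \<open>a\<close>. If \<open>u > 0\<close> on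
  the part of the shrinker in the ball of radius \<open>a\<close> that lies on one side of the cylinder, then at a
  maximum point \<open>p\<close> of \<open>w / u\<close> a suitable multiple \<open>\<mu> w\<close> touches \<open>u\<close> from below, which contradicts
  these inequalities.\<close>

section \<open>Smooth maps and Gram--Schmidt\<close>

text \<open>On an open set equality passes to the derivatives at each point, so the induction can
  move from \<open>f\<close> and \<open>g\<close> to their directional derivatives.\<close>

lemma Ck_on_cong:
  assumes "open U" "\<And>x. x \<in> U \<Longrightarrow> f x = g x" "Ck_on k U f"
  shows "Ck_on k U g"
  using assms(2,3)
proof (induction k arbitrary: f g)
  case 0
  then show ?case by (simp cong: continuous_on_cong)
next
  case (Suc k)
  have g: "(g has_derivative frechet_derivative f (at x)) (at x)" if x: "x \<in> U" for x
  proof -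
    have "(f has_derivative frechet_derivative f (at x)) (at x)"
      using x Suc.prems by (simp add: frechet_derivative_works)
    then show ?thesis
      by (rule has_derivative_transform_within_open[OF _ \<open>open U\<close> x]) (use Suc.prems in auto)
  qed
  have "Ck_on k U (\<lambda>x. frechet_derivative g (at x) v)" for v
    by (rule Suc.IH[of "\<lambda>x. frechet_derivative f (at x) v"])
      (use Suc.prems frechet_derivative_at[OF g] in auto)
  then show ?case
    using g by (auto simp: differentiable_def)
qed

text \<open>Lets a derivative obtained from the usual rules stand in for the chosen
  \<open>frechet_derivative\<close>, with which it agrees by uniqueness.\<close>

lemma Ck_on_Suc_intro:
  assumes "open U" "\<And>x. x \<in> U \<Longrightarrow> (f has_derivative f' x) (at x)"
    and "\<And>v. Ck_on k U (\<lambda>x. f' x v)"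
  shows "Ck_on (Suc k) U f"
proof -
  have "Ck_on k U (\<lambda>x. frechet_derivative f (at x) v)" for v
    by (rule Ck_on_cong[OF assms(1) _ assms(3)[of v]])
      (use frechet_derivative_at[OF assms(2)] in auto)
  then show ?thesis
    using assms(2) by (auto simp: differentiable_def)
qed

lemma Ck_on_has_derivative:
  assumes "Ck_on (Suc k) U f" "x \<in> U"
  shows "(f has_derivative frechet_derivative f (at x)) (at x)"
  using assms by (simp add: frechet_derivative_works)

lemma Ck_on_SucD: "Ck_on (Suc k) U f \<Longrightarrow> Ck_on k U f"
proof (induction k arbitrary: f)
  case 0
  then show ?case
    by (auto intro!: continuous_at_imp_continuous_on differentiable_imp_continuous_within)
next
  case (Suc k)
  have "Ck_on k U (\<lambda>x. frechet_derivative f (at x) v)" for v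
    using Suc.prems Ck_on.simps(2) by (intro Suc.IH) blast
  then show ?case
    using Suc.prems Ck_on.simps(2) by blast
qed

lemma Ck_on_const: "open U \<Longrightarrow> Ck_on k U (\<lambda>x. c)"
  by (induction k arbitrary: c) (auto intro!: Ck_on_Suc_intro derivative_eq_intros simp del: Ck_on.simps(2))

lemma Ck_on_add:
  assumes "open U" "Ck_on k U f" "Ck_on k U g"
  shows "Ck_on k U (\<lambda>x. f x + g x)"
  using assms(2,3)
proof (induction k arbitrary: f g)
  case 0
  then show ?case by (simp add: continuous_on_add)
next
  case (Suc k)
  show ?case
  proof (rule Ck_on_Suc_intro[OF \<open>open U\<close>])
    show "((\<lambda>x. f x + g x) has_derivative
        (\<lambda>v. frechet_derivative f (at x) v + frechet_derivative g (at x) v)) (at x)" if "x \<in> U" for x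
      using Suc.prems[THEN Ck_on_has_derivative, OF that] by (rule has_derivative_add)
    show "Ck_on k U (\<lambda>x. frechet_derivative f (at x) v + frechet_derivative g (at x) v)" for v
      using Suc by simp
  qed
qed

lemma Ck_on_sum:
  assumes "open U" "\<And>i. i \<in> I \<Longrightarrow> Ck_on k U (f i)"
  shows "Ck_on k U (\<lambda>x. \<Sum>i\<in>I. f i x)"
  using assms(2)
  by (induction I rule: infinite_finite_induct) (auto intro!: Ck_on_add Ck_on_const assms(1))

lemma Ck_on_bilinear:
  assumes "bounded_bilinear B" "open U" "Ck_on k U f" "Ck_on k U g"
  shows "Ck_on k U (\<lambda>x. B (f x) (g x))"
  using assms(3,4)
proof (induction k arbitrary: f g)
  case 0
  then show ?case by (simp add: bounded_bilinear.continuous_on[OF assms(1)])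
next
  case (Suc k)
  show ?case
  proof (rule Ck_on_Suc_intro[OF \<open>open U\<close>])
    show "((\<lambda>x. B (f x) (g x)) has_derivative
        (\<lambda>v. B (f x) (frechet_derivative g (at x) v) + B (frechet_derivative f (at x) v) (g x))) (at x)"
      if "x \<in> U" for x
      using Suc.prems[THEN Ck_on_has_derivative, OF that] by (rule bounded_bilinear.FDERIV[OF assms(1)])
    show "Ck_on k U (\<lambda>x. B (f x) (frechet_derivative g (at x) v) + B (frechet_derivative f (at x) v) (g x))" for v
      using Suc Suc.prems[THEN Ck_on_SucD] by (intro Ck_on_add[OF \<open>open U\<close>] Suc.IH) auto
  qed
qed

lemma linear_eq_sum_Basis:
  fixes f :: "'a::euclidean_space \<Rightarrow> 'b::real_vector"
  assumes "linear f"
  shows "f v = (\<Sum>b\<in>Basis. (v \<bullet> b) *\<^sub>R f b)"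
  using linear_sum[OF assms, of "\<lambda>b. (v \<bullet> b) *\<^sub>R b" Basis] linear_scale[OF assms]
  by (simp add: euclidean_representation)

text \<open>The chain rule gives \<open>f'(g x) (g' x v)\<close>, whose direction varies with
  \<open>x\<close>, while \<open>Ck_on\<close> controls derivatives in fixed directions only.
  Expanding the direction in \<open>Basis\<close> turns it into a sum of products of scalar
  coefficients and derivatives in fixed directions.\<close>

lemma Ck_on_compose:
  assumes "open U" "open V" "g ` U \<subseteq> V" "Ck_on k V f" "Ck_on k U g"
  shows "Ck_on k U (\<lambda>x. f (g x))"
  using assms(4,5)
proof (induction k arbitrary: f)
  case 0
  then show ?case using assms(3) continuous_on_compose2 by fastforce
next
  case (Suc k)
  let ?f' = "\<lambda>y. frechet_derivative f (at y)"
  let ?g' = "\<lambda>x. frechet_derivative g (at x)"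
  show ?case
  proof (rule Ck_on_Suc_intro[OF \<open>open U\<close>])
    fix x assume x: "x \<in> U"
    then have gx: "g x \<in> V" using assms(3) by auto
    have df: "(f has_derivative ?f' (g x)) (at (g x))"
      using Suc.prems(1) gx by (rule Ck_on_has_derivative)
    have "((\<lambda>x. f (g x)) has_derivative (\<lambda>v. ?f' (g x) (?g' x v))) (at x)"
      using has_derivative_compose[OF Ck_on_has_derivative[OF Suc.prems(2) x] df] .
    moreover have "?f' (g x) (?g' x v) = (\<Sum>b\<in>Basis. (?g' x v \<bullet> b) *\<^sub>R ?f' (g x) b)" for v
      by (rule linear_eq_sum_Basis[OF has_derivative_linear[OF df]])
    ultimately show "((\<lambda>x. f (g x)) has_derivative
      (\<lambda>v. \<Sum>b\<in>Basis. (?g' x v \<bullet> b) *\<^sub>R ?f' (g x) b)) (at x)"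
      by (rule has_derivative_eq_rhs[OF _ ext])
  next
    fix v
    show "Ck_on k U (\<lambda>x. \<Sum>b\<in>Basis. (?g' x v \<bullet> b) *\<^sub>R ?f' (g x) b)"
      by (intro Ck_on_sum \<open>open U\<close> Ck_on_bilinear[OF bounded_bilinear_scaleR]
          Ck_on_bilinear[OF bounded_bilinear_inner] Ck_on_const Suc.IH Ck_on_SucD[OF Suc.prems(2)])
        (use Suc.prems in simp_all)
  qed
qed

text \<open>With \<open>r = 1 / sqrt g\<close> the derivative is \<open>- r^3 g' / 2\<close>, a
  product involving only \<open>r\<close> and \<open>g'\<close>, so the induction closes.\<close>

lemma Ck_on_inverse_sqrt:
  fixes g :: "'a::euclidean_space \<Rightarrow> real"
  assumes "open U" "Ck_on k U g" "\<And>x. x \<in> U \<Longrightarrow> g x > 0"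
  shows "Ck_on k U (\<lambda>x. inverse (sqrt (g x)))"
  using assms(2)
proof (induction k)
  case 0
  have "\<forall>x\<in>U. g x \<noteq> 0" using assms(3) by force
  with 0 show ?case by (auto intro!: continuous_intros)
next
  case (Suc k)
  let ?r = "\<lambda>x. inverse (sqrt (g x))"
  let ?g' = "\<lambda>x. frechet_derivative g (at x)"
  have r: "Ck_on k U ?r" using Suc Ck_on_SucD by blast
  show ?case
  proof (rule Ck_on_Suc_intro[OF \<open>open U\<close>])
    fix x assume x: "x \<in> U"
    have g: "(g has_derivative ?g' x) (at x)"
      using Ck_on_has_derivative[OF Suc.prems x] .
    have "((\<lambda>y. inverse (sqrt y)) has_real_derivative
        - (?r x * (inverse (sqrt (g x)) / 2) * ?r x)) (at (g x))"
      using assms(3)[OF x] by (intro DERIV_inverse' DERIV_real_sqrt) auto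
    then have "((\<lambda>y. inverse (sqrt y)) has_derivative (*) (- (?r x * (?r x / 2) * ?r x))) (at (g x))"
      by (simp only: has_field_derivative_def)
    from has_derivative_compose[OF g this]
    show "(?r has_derivative (\<lambda>v. (- 1/2) * (?r x * (?r x * (?r x * ?g' x v))))) (at x)"
      by (rule has_derivative_eq_rhs) (simp add: mult_ac)
  next
    fix v
    show "Ck_on k U (\<lambda>x. (- 1/2) * (?r x * (?r x * (?r x * ?g' x v))))"
      using Suc.prems
      by (intro Ck_on_bilinear[OF bounded_bilinear_mult] Ck_on_const \<open>open U\<close> r) simp
  qed
qed

lemma smooth_on_normalize:
  assumes "smooth_on U f" "\<And>x. x \<in> U \<Longrightarrow> f x \<noteq> 0"
  shows "smooth_on U (\<lambda>x. inverse (sqrt (f x \<bullet> f x)) *\<^sub>R f x)"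
  using assms unfolding smooth_on_def
  by (auto intro!: Ck_on_bilinear[OF bounded_bilinear_scaleR] Ck_on_inverse_sqrt
      Ck_on_bilinear[OF bounded_bilinear_inner])

lemma smooth_on_minus_projection:
  assumes "smooth_on U h" "\<And>j. j \<in> J \<Longrightarrow> smooth_on U (f j)"  "open U"
  shows "smooth_on U (\<lambda>x. h x - (\<Sum>j\<in>J. (h x \<bullet> f j x) *\<^sub>R f j x))"
proof -
  have "smooth_on U (\<lambda>x. h x + (\<Sum>j\<in>J. - 1 *\<^sub>R ((h x \<bullet> f j x) *\<^sub>R f j x)))"
    unfolding smooth_on_def
    by (intro conjI allI Ck_on_add Ck_on_sum Ck_on_bilinear[OF bounded_bilinear_scaleR] Ck_on_const
      Ck_on_bilinear[OF bounded_bilinear_inner]) (use assms in \<open>auto simp: smooth_on_def\<close>)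
  then show ?thesis by (simp add: sum_negf)
qed

text \<open>Pointwise independence is stated one vector at a time, which is exactly what keeps each
  Gram-Schmidt residual away from zero on all of \<open>U\<close>; normalising it is then
  smooth.\<close>

lemma smooth_gram_schmidt:
  fixes E :: "nat \<Rightarrow> 'a::euclidean_space \<Rightarrow> 'b::euclidean_space"
  assumes "open U" "\<And>i. i < m \<Longrightarrow> smooth_on U (E i)"
    and "\<And>i q. i < m \<Longrightarrow> q \<in> U \<Longrightarrow> E i q \<notin> span ((\<lambda>j. E j q) ` {..<i})"
  shows "\<exists>f. (\<forall>i<m. smooth_on U (f i)) \<and>
    (\<forall>q\<in>U. \<forall>i<m. f i q \<in> span ((\<lambda>j. E j q) ` {..<m}) \<and>
        (\<forall>j<m. f i q \<bullet> f j q = (if i = j then 1 else 0)))"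
  using assms(2,3)
proof (induction m)
  case 0
  then show ?case by simp
next
  case (Suc m)
  have "\<exists>f. (\<forall>i<m. smooth_on U (f i)) \<and>
    (\<forall>q\<in>U. \<forall>i<m. f i q \<in> span ((\<lambda>j. E j q) ` {..<m}) \<and>
        (\<forall>j<m. f i q \<bullet> f j q = (if i = j then 1 else 0)))"
    by (rule Suc.IH) (use Suc.prems in auto)
  then obtain f where f: "\<And>i. i < m \<Longrightarrow> smooth_on U (f i)"
    "\<And>q i. q \<in> U \<Longrightarrow> i < m \<Longrightarrow> f i q \<in> span ((\<lambda>j. E j q) ` {..<m})"
    "\<And>q i j. q \<in> U \<Longrightarrow> i < m \<Longrightarrow> j < m \<Longrightarrow> f i q \<bullet> f j q = (if i = j then 1 else 0)"
    by blast
  define w where "w = (\<lambda>q. E m q - (\<Sum>j<m. (E m q \<bullet> f j q) *\<^sub>R f j q))"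
  define e where "e = (\<lambda>q. inverse (sqrt (w q \<bullet> w q)) *\<^sub>R w q)"
  have w0: "w q \<noteq> 0" if "q \<in> U" for q
  proof
    assume "w q = 0"
    then have "E m q = (\<Sum>j<m. (E m q \<bullet> f j q) *\<^sub>R f j q)" by (simp add: w_def)
    also have "\<dots> \<in> span ((\<lambda>j. E j q) ` {..<m})"
      using f(2)[OF that] by (intro span_sum span_scale) auto
    finally show False using Suc.prems(2)[OF _ that] by blast
  qed
  have sw: "smooth_on U w"
    unfolding w_def by (rule smooth_on_minus_projection) (use Suc.prems f assms(1) in auto)
  have se: "smooth_on U e"
    unfolding e_def by (rule smooth_on_normalize[OF sw w0])
  have orth: "w q \<bullet> f i q = 0" if "q \<in> U" "i < m" for q i
  proof -
    have "(\<Sum>j<m. (E m q \<bullet> f j q) * (f j q \<bullet> f i q)) = (\<Sum>j<m. if j = i then E m q \<bullet> f j q else 0)"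
      using f(3)[OF that(1) _ that(2)] by (intro sum.cong) auto
    then show ?thesis
      using that by (simp add: w_def inner_diff_left inner_sum_left)
  qed
  have ee: "e q \<bullet> e q = 1" if "q \<in> U" for q
    using w0[OF that] by (simp add: e_def flip: power2_eq_square) (simp add: field_simps)
  have mono: "span ((\<lambda>j. E j q) ` {..<m}) \<subseteq> span ((\<lambda>j. E j q) ` {..<Suc m})" for q
    by (intro span_mono) auto
  have ew: "e q \<in> span ((\<lambda>j. E j q) ` {..<Suc m})" if "q \<in> U" for q
  proof -
    have "f j q \<in> span ((\<lambda>j. E j q) ` {..<Suc m})" if "j < m" for j
      using f(2)[OF \<open>q \<in> U\<close> that] mono by blast
    then show ?thesis
      unfolding e_def w_def by (intro span_scale span_diff span_sum) (auto intro: span_base)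
  qed
  have eorth: "e q \<bullet> f i q = 0" "f i q \<bullet> e q = 0" if "q \<in> U" "i < m" for q i
    using orth[OF that] by (auto simp: e_def inner_commute)
  show ?case
  proof (intro exI[of _ "\<lambda>i. if i = m then e else f i"] conjI allI impI ballI)
    fix q i assume "q \<in> U" "i < Suc m"
    then show "(if i = m then e else f i) q \<in> span ((\<lambda>j. E j q) ` {..<Suc m})"
      using f(2)[of q i] ew[of q] mono[of q] by (cases "i = m") auto
  qed (use f(1,3) se ee eorth in \<open>auto simp: less_Suc_eq\<close>)
qed

section \<open>Traces, minima and normal parts\<close>

text \<open>An orthonormal family of \<open>dim T\<close> vectors of \<open>T\<close> is independent
  and therefore spans \<open>T\<close>. The remainder of the expansion lies in \<open>T\<close> and
  is orthogonal to the family, so it is orthogonal to itself.\<close>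

lemma orthonormal_expansion:
  fixes f :: "nat \<Rightarrow> 'a::euclidean_space"
  assumes "subspace T" "dim T = n" "\<And>i. i < n \<Longrightarrow> f i \<in> T"
    and on: "\<And>i j. i < n \<Longrightarrow> j < n \<Longrightarrow> f i \<bullet> f j = (if i = j then 1 else 0)"
    and "v \<in> T"
  shows "v = (\<Sum>i<n. (v \<bullet> f i) *\<^sub>R f i)"
proof -
  let ?w = "v - (\<Sum>i<n. (v \<bullet> f i) *\<^sub>R f i)"
  have inj: "inj_on f {..<n}"
  proof (rule inj_onI)
    fix i j assume "i \<in> {..<n}" "j \<in> {..<n}" "f i = f j"
    then show "i = j" using on[of i j] on[of i i] by (auto split: if_splits)
  qed
  have indep: "independent (f ` {..<n})"
    by (rule pairwise_orthogonal_independent)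
      (use on in \<open>auto simp: pairwise_def orthogonal_def, force\<close>)
  have span: "T \<subseteq> span (f ` {..<n})"
    by (rule card_ge_dim_independent[OF _ indep]) (use assms inj in \<open>auto simp: card_image\<close>)
  have orth: "?w \<bullet> f j = 0" if "j < n" for j
  proof -
    have "(\<Sum>i<n. (v \<bullet> f i) * (f i \<bullet> f j)) = (\<Sum>i<n. if i = j then v \<bullet> f i else 0)"
      using on that by (intro sum.cong) auto
    then show ?thesis using that by (simp add: inner_diff_left inner_sum_left)
  qed
  have "?w \<in> T"
    using assms by (intro subspace_diff subspace_sum subspace_scale) auto
  then have "orthogonal ?w ?w"
    using span orth by (intro orthogonal_to_span[of ?w "f ` {..<n}"]) (auto simp: orthogonal_def)
  then show ?thesis by (simp add: orthogonal_def)
qed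

lemma orthonormal_bessel:
  fixes f :: "nat \<Rightarrow> 'a::euclidean_space"
  assumes on: "\<And>i j. i < n \<Longrightarrow> j < n \<Longrightarrow> f i \<bullet> f j = (if i = j then 1 else 0)"
  shows "(\<Sum>i<n. (v \<bullet> f i)\<^sup>2) \<le> v \<bullet> v"
proof -
  let ?s = "\<Sum>i<n. (v \<bullet> f i) *\<^sub>R f i"
  have "?s \<bullet> f j = v \<bullet> f j" if "j < n" for j
  proof -
    have "(\<Sum>i<n. (v \<bullet> f i) * (f i \<bullet> f j)) = (\<Sum>i<n. if i = j then v \<bullet> f i else 0)"
      using on that by (intro sum.cong) auto
    then show ?thesis using that by (simp add: inner_sum_left)
  qed
  then have "?s \<bullet> ?s = v \<bullet> ?s"
    by (simp add: inner_sum_right)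
  moreover have "v \<bullet> ?s = (\<Sum>i<n. (v \<bullet> f i)\<^sup>2)"
    by (simp add: inner_sum_right power2_eq_square)
  moreover have "0 \<le> (v - ?s) \<bullet> (v - ?s)" by simp
  ultimately show ?thesis
    by (simp add: inner_diff_left inner_diff_right inner_commute)
qed

text \<open>By symmetry of \<open>Q\<close> the left side is the double sum of
  \<open>(Q b \<bullet> f i)\<^sup>2\<close>; after exchanging the sums, Bessel's inequality applies
  to each \<open>Q b\<close>. For an orthogonal projection the right side is its rank.\<close>

lemma orthonormal_trace_le:
  fixes f :: "nat \<Rightarrow> 'a::euclidean_space"
  assumes on: "\<And>i j. i < n \<Longrightarrow> j < n \<Longrightarrow> f i \<bullet> f j = (if i = j then 1 else 0)"
    and Q: "\<And>x y. Q x \<bullet> y = x \<bullet> Q y"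
  shows "(\<Sum>i<n. Q (f i) \<bullet> Q (f i)) \<le> (\<Sum>b\<in>Basis. Q b \<bullet> Q b)"
proof -
  have "(\<Sum>i<n. Q (f i) \<bullet> Q (f i)) = (\<Sum>i<n. \<Sum>b\<in>Basis. (Q b \<bullet> f i)\<^sup>2)"
    by (subst euclidean_inner) (simp add: Q inner_commute power2_eq_square)
  also have "\<dots> = (\<Sum>b\<in>Basis. \<Sum>i<n. (Q b \<bullet> f i)\<^sup>2)"
    by (rule sum.swap)
  also have "\<dots> \<le> (\<Sum>b\<in>Basis. Q b \<bullet> Q b)"
    by (intro sum_mono orthonormal_bessel on)
  finally show ?thesis .
qed

text \<open>The transition matrix between two orthonormal bases of \<open>T\<close> is orthogonal:
  after expanding in \<open>g\<close>, the sum over \<open>i\<close> of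
  \<open>(f i \<bullet> g j) * (f i \<bullet> g k)\<close> collapses to
  \<open>g j \<bullet> g k\<close>. This makes the mean curvature independent of the frame.\<close>

lemma bilinear_trace_eq:
  fixes f g :: "nat \<Rightarrow> 'a::euclidean_space" and B :: "'a \<Rightarrow> 'a \<Rightarrow> 'b::real_vector"
  assumes B: "bilinear B" and T: "subspace T" "dim T = n"
    and f: "\<And>i. i < n \<Longrightarrow> f i \<in> T"
      "\<And>i j. i < n \<Longrightarrow> j < n \<Longrightarrow> f i \<bullet> f j = (if i = j then 1 else 0)"
    and g: "\<And>i. i < n \<Longrightarrow> g i \<in> T"
      "\<And>i j. i < n \<Longrightarrow> j < n \<Longrightarrow> g i \<bullet> g j = (if i = j then 1 else 0)"
  shows "(\<Sum>i<n. B (f i) (f i)) = (\<Sum>i<n. B (g i) (g i))"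
proof -
  have "B (f i) (f i) = (\<Sum>j<n. \<Sum>k<n. ((f i \<bullet> g j) * (f i \<bullet> g k)) *\<^sub>R B (g j) (g k))" if "i < n" for i
  proof -
    have "B (f i) (f i) = B (\<Sum>j<n. (f i \<bullet> g j) *\<^sub>R g j) (\<Sum>k<n. (f i \<bullet> g k) *\<^sub>R g k)"
      using orthonormal_expansion[OF T g f(1)[OF that]] by simp
    also have "\<dots> = (\<Sum>(j, k)\<in>{..<n} \<times> {..<n}. B ((f i \<bullet> g j) *\<^sub>R g j) ((f i \<bullet> g k) *\<^sub>R g k))"
      using B by (intro bilinear_sum) auto
    finally show ?thesis
      by (simp add: sum.cartesian_product bilinear_lmul[OF B] bilinear_rmul[OF B] mult.commute)
  qed
  then have "(\<Sum>i<n. B (f i) (f i)) =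
      (\<Sum>i<n. \<Sum>j<n. \<Sum>k<n. ((f i \<bullet> g j) * (f i \<bullet> g k)) *\<^sub>R B (g j) (g k))"
    by simp
  also have "\<dots> = (\<Sum>j<n. \<Sum>k<n. \<Sum>i<n. ((f i \<bullet> g j) * (f i \<bullet> g k)) *\<^sub>R B (g j) (g k))"
    by (subst sum.swap) (intro sum.cong refl sum.swap)
  also have "\<dots> = (\<Sum>j<n. \<Sum>k<n. (g j \<bullet> g k) *\<^sub>R B (g j) (g k))"
  proof (intro sum.cong refl)
    fix j k assume "j \<in> {..<n}" "k \<in> {..<n}"
    then have "g j \<bullet> g k = (\<Sum>i<n. (g j \<bullet> f i) *\<^sub>R f i) \<bullet> g k"
      using orthonormal_expansion[OF T f g(1), of j] by simp
    then show "(\<Sum>i<n. ((f i \<bullet> g j) * (f i \<bullet> g k)) *\<^sub>R B (g j) (g k)) = (g j \<bullet> g k) *\<^sub>R B (g j) (g k)"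
      by (simp only: scaleR_sum_left[symmetric] inner_sum_left inner_scaleR_left inner_commute[of _ "g j"])
  qed
  also have "\<dots> = (\<Sum>j<n. B (g j) (g j))"
  proof (rule sum.cong[OF refl])
    fix j assume j: "j \<in> {..<n}"
    then have "(\<Sum>k<n. (g j \<bullet> g k) *\<^sub>R B (g j) (g k)) = (\<Sum>k<n. if k = j then B (g j) (g k) else 0)"
      using g(2) by (intro sum.cong) auto
    then show "(\<Sum>k<n. (g j \<bullet> g k) *\<^sub>R B (g j) (g k)) = B (g j) (g j)"
      using j by simp
  qed
  finally show ?thesis .
qed

section \<open>Derivatives along curves\<close>

text \<open>If \<open>d\<close> were negative, \<open>h'\<close> would be negative just to the right
  of 0, where it vanishes, and \<open>h\<close> would drop below \<open>h 0\<close>.\<close>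

lemma second_derivative_at_min:
  fixes h h' :: "real \<Rightarrow> real"
  assumes "0 < \<epsilon>" "\<And>t. \<bar>t\<bar> < \<epsilon> \<Longrightarrow> (h has_real_derivative h' t) (at t)"
    and "(h' has_real_derivative d) (at 0)" and min: "\<And>t. \<bar>t\<bar> < \<epsilon> \<Longrightarrow> h 0 \<le> h t"
  shows "h' 0 = 0" "d \<ge> 0"
proof -
  show h'0: "h' 0 = 0"
    using assms by (intro DERIV_local_min[of h _ 0 \<epsilon>]) auto
  show "d \<ge> 0"
  proof (rule ccontr)
    assume "\<not> d \<ge> 0"
    then obtain \<delta> where \<delta>: "\<delta> > 0" "\<And>t. 0 < t \<Longrightarrow> t < \<delta> \<Longrightarrow> h' t < 0"
      using DERIV_neg_dec_right[OF assms(3)] h'0 by auto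
    define b where "b = min \<delta> \<epsilon> / 2"
    have b: "0 < b" "b < \<delta>" "b < \<epsilon>"
      using \<delta>(1) assms(1) by (auto simp: b_def min_def)
    have "h b < h 0"
    proof (rule DERIV_neg_imp_decreasing_open[OF b(1)])
      fix t assume "0 < t" "t < b"
      then show "\<exists>y. (h has_real_derivative y) (at t) \<and> y < 0"
        using assms(2)[of t] \<delta>(2)[of t] b by auto
    next
      show "continuous_on {0..b} h"
        by (rule DERIV_atLeastAtMost_imp_continuous_on) (use assms(2) b in force)
    qed
    then show False using min[of b] b by auto
  qed
qed

text \<open>The difference quotients lie in \<open>L\<close>, which is closed. The set
  \<open>T\<close> allows both the one-sided curves in the definition of
  \<open>tangent_space\<close> and two-sided ones.\<close>

lemma has_vector_derivative_in_subspace: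
  fixes g :: "real \<Rightarrow> 'a::euclidean_space"
  assumes "subspace L" "(g has_vector_derivative d) (at t within T)" "at t within T \<noteq> bot"
    and "g t \<in> L" "\<forall>\<^sub>F s in at t within T. g s \<in> L"
  shows "d \<in> L"
proof -
  have "((\<lambda>s. (g s - g t) /\<^sub>R (s - t)) \<longlongrightarrow> d) (at t within T)"
  proof -
    have "((\<lambda>s. norm (g s - g t - (s - t) *\<^sub>R d) / norm (s - t)) \<longlongrightarrow> 0) (at t within T)"
      using assms(2) by (simp add: has_vector_derivative_def has_derivative_iff_norm)
    then have "((\<lambda>s. norm ((g s - g t) /\<^sub>R (s - t) - d)) \<longlongrightarrow> 0) (at t within T)"
    proof (rule Lim_transform_eventually)
      show "\<forall>\<^sub>F s in at t within T. norm (g s - g t - (s - t) *\<^sub>R d) / norm (s - t) =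
          norm ((g s - g t) /\<^sub>R (s - t) - d)"
      proof (unfold eventually_at_filter, intro always_eventually allI impI)
        fix s assume "s \<noteq> t"
        then have "(g s - g t) /\<^sub>R (s - t) - d = (g s - g t - (s - t) *\<^sub>R d) /\<^sub>R (s - t)"
          by (simp add: scaleR_diff_right)
        then show "norm (g s - g t - (s - t) *\<^sub>R d) / norm (s - t) = norm ((g s - g t) /\<^sub>R (s - t) - d)"
          by (simp add: divide_inverse mult.commute)
      qed
    qed
    then show ?thesis by (simp only: tendsto_norm_zero_iff LIM_zero_iff)
  qed
  moreover have "\<forall>\<^sub>F s in at t within T. (g s - g t) /\<^sub>R (s - t) \<in> L"
    using assms(5) by eventually_elim (intro subspace_scale subspace_diff assms(1,4))
  ultimately show ?thesis
    by (intro Lim_in_closed_set[OF closed_subspace[OF assms(1)] _ assms(3)])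
qed

section \<open>The projection to the normal space\<close>

text \<open>These facts unlock the definite description in \<open>normal_part\<close>. Orthogonal
  decomposition gives existence; the difference of two candidates is both tangent and normal, hence
  zero.\<close>

lemma normal_part_decomposition:
  "normal_part S p v \<in> orthogonal_comp (tangent_space S p)"
  "v - normal_part S p v \<in> tangent_space S p"
  and normal_part_eqI: "w \<in> orthogonal_comp (tangent_space S p) \<Longrightarrow>
    v - w \<in> tangent_space S p \<Longrightarrow> normal_part S p v = w"
proof -
  let ?T = "tangent_space S p"
  have T: "subspace ?T" by (simp add: tangent_space_def)
  have unique: "w = w'" if "w \<in> orthogonal_comp ?T" "v - w \<in> ?T"
    "w' \<in> orthogonal_comp ?T" "v - w' \<in> ?T" for w w'
  proof -
    have "(v - w') - (v - w) \<in> ?T" using subspace_diff[OF T that(4) that(2)] .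
    moreover have "w - w' \<in> orthogonal_comp ?T"
      using subspace_diff[OF subspace_orthogonal_comp that(1) that(3)] .
    ultimately have "orthogonal (w - w') (w - w')"
      by (simp add: orthogonal_comp_def)
    then show ?thesis by (simp add: orthogonal_def)
  qed
  obtain y z where yz: "y \<in> span ?T" "\<And>w. w \<in> span ?T \<Longrightarrow> orthogonal z w" "v = y + z"
    using orthogonal_subspace_decomp_exists[of ?T v] by metis
  have "z \<in> orthogonal_comp ?T \<and> v - z \<in> ?T"
    using yz T by (auto simp: orthogonal_comp_def span_eq_iff[THEN iffD2] orthogonal_commute)
  then have ex1: "\<exists>!w. w \<in> orthogonal_comp ?T \<and> v - w \<in> ?T"
    using unique by blast
  show "normal_part S p v \<in> orthogonal_comp ?T" "v - normal_part S p v \<in> ?T"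
    using theI'[OF ex1] unfolding normal_part_def by auto
  then show "normal_part S p v = w" if "w \<in> orthogonal_comp ?T" "v - w \<in> ?T"
    using unique that by blast
qed

lemma linear_normal_part: "linear (normal_part S p)"
proof
  have T: "subspace (tangent_space S p)" by (simp add: tangent_space_def)
  note N = subspace_orthogonal_comp[of "tangent_space S p"]
  show "normal_part S p (x + y) = normal_part S p x + normal_part S p y" for x y
    using subspace_add[OF N normal_part_decomposition(1) normal_part_decomposition(1)]
      subspace_add[OF T normal_part_decomposition(2) normal_part_decomposition(2), of x y]
    by (intro normal_part_eqI) (auto simp: algebra_simps)
  show "normal_part S p (c *\<^sub>R x) = c *\<^sub>R normal_part S p x" for c x
    using subspace_scale[OF N normal_part_decomposition(1)]
      subspace_scale[OF T normal_part_decomposition(2)]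
    by (intro normal_part_eqI) (auto simp: algebra_simps)
qed

lemma normal_part_tangent: "v \<in> tangent_space S p \<Longrightarrow> normal_part S p v = 0"
  by (intro normal_part_eqI) (auto simp: subspace_0 subspace_orthogonal_comp)

section \<open>Mean curvature in a slice chart\<close>

locale slice_chart =
  fixes n :: nat and S U V L :: "'a::euclidean_space set" and \<phi> \<psi> :: "'a \<Rightarrow> 'a"
  assumes diffeo: "diffeomorphism U V \<phi> \<psi>"
    and subspace_L: "subspace L" and dim_L: "dim L = n"
    and image_eq: "\<phi> ` (U \<inter> S) = V \<inter> L"
begin

abbreviation D\<phi> :: "'a \<Rightarrow> 'a \<Rightarrow> 'a" where "D\<phi> x \<equiv> frechet_derivative \<phi> (at x)"
abbreviation D\<psi> :: "'a \<Rightarrow> 'a \<Rightarrow> 'a" where "D\<psi> y \<equiv> frechet_derivative \<psi> (at y)"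

text \<open>The second derivative of \<psi> at \<open>y\<close> in the directions \<open>l\<close>
  and \<open>m\<close>. Expanding \<open>m\<close> in \<open>Basis\<close> means that only maps
  \<open>y \<mapsto> D\<psi> y b\<close> with fixed \<open>b\<close> are differentiated.\<close>

definition hess :: "'a \<Rightarrow> 'a \<Rightarrow> 'a \<Rightarrow> 'a" where
  "hess y l m = (\<Sum>b\<in>Basis. (m \<bullet> b) *\<^sub>R frechet_derivative (\<lambda>y. D\<psi> y b) (at y) l)"

lemma open_sets: "open U" "open V"
  and smooth: "Ck_on k U \<phi>" "Ck_on k V \<psi>"
  using diffeo by (auto simp: diffeomorphism_def smooth_on_def)

lemma maps: "x \<in> U \<Longrightarrow> \<phi> x \<in> V" "y \<in> V \<Longrightarrow> \<psi> y \<in> U"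
  "x \<in> U \<Longrightarrow> \<psi> (\<phi> x) = x" "y \<in> V \<Longrightarrow> \<phi> (\<psi> y) = y"
  using diffeo unfolding diffeomorphism_def homeomorphism_def by blast+

lemma mem_iff: "x \<in> U \<Longrightarrow> x \<in> S \<longleftrightarrow> \<phi> x \<in> L"
proof
  assume x: "x \<in> U"
  show "\<phi> x \<in> L" if "x \<in> S"
  proof -
    have "\<phi> x \<in> \<phi> ` (U \<inter> S)" using x that by (intro imageI IntI)
    then show ?thesis unfolding image_eq by (rule IntD2)
  qed
  assume "\<phi> x \<in> L"
  then have "\<phi> x \<in> \<phi> ` (U \<inter> S)" unfolding image_eq by (rule IntI[OF maps(1)[OF x]])
  then obtain y where y: "y \<in> U" "y \<in> S" "\<phi> x = \<phi> y" by (elim imageE IntE)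
  have "x = y" using maps(3)[OF x] maps(3)[OF y(1)] unfolding y(3) by (rule trans[OF sym])
  then show "x \<in> S" using y(2) by (rule ssubst)
qed

lemma D\<phi>: "x \<in> U \<Longrightarrow> (\<phi> has_derivative D\<phi> x) (at x)"
  and D\<psi>: "y \<in> V \<Longrightarrow> (\<psi> has_derivative D\<psi> y) (at y)"
  and D2\<phi>: "x \<in> U \<Longrightarrow>
    ((\<lambda>x. D\<phi> x b) has_derivative frechet_derivative (\<lambda>x. D\<phi> x b) (at x)) (at x)"
  and D2\<psi>: "y \<in> V \<Longrightarrow>
    ((\<lambda>y. D\<psi> y b) has_derivative frechet_derivative (\<lambda>y. D\<psi> y b) (at y)) (at y)"
proof -
  show "x \<in> U \<Longrightarrow> (\<phi> has_derivative D\<phi> x) (at x)" "y \<in> V \<Longrightarrow> (\<psi> has_derivative D\<psi> y) (at y)"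
    by (rule Ck_on_has_derivative[OF smooth(1)], assumption) (rule Ck_on_has_derivative[OF smooth(2)])
  have "Ck_on (Suc 0) U (\<lambda>x. D\<phi> x b)" "Ck_on (Suc 0) V (\<lambda>y. D\<psi> y b)"
    using smooth[of "Suc (Suc 0)"] by (simp_all only: Ck_on.simps(2)[of "Suc 0"])
  from this[THEN Ck_on_has_derivative] show "x \<in> U \<Longrightarrow>
      ((\<lambda>x. D\<phi> x b) has_derivative frechet_derivative (\<lambda>x. D\<phi> x b) (at x)) (at x)"
    "y \<in> V \<Longrightarrow>
      ((\<lambda>y. D\<psi> y b) has_derivative frechet_derivative (\<lambda>y. D\<psi> y b) (at y)) (at y)"
    by (simp_all only:)
qed

lemma linear_D: "x \<in> U \<Longrightarrow> linear (D\<phi> x)" "y \<in> V \<Longrightarrow> linear (D\<psi> y)"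
  by (rule has_derivative_linear[OF D\<phi>], assumption) (rule has_derivative_linear[OF D\<psi>])

lemma inverse_D: "x \<in> U \<Longrightarrow> D\<psi> (\<phi> x) (D\<phi> x v) = v" "x \<in> U \<Longrightarrow> D\<phi> x (D\<psi> (\<phi> x) v) = v"
proof -
  assume x: "x \<in> U"
  have "((\<lambda>x. \<psi> (\<phi> x)) has_derivative (\<lambda>v. D\<psi> (\<phi> x) (D\<phi> x v))) (at x)"
    using has_derivative_compose[OF D\<phi>[OF x] D\<psi>[OF maps(1)[OF x]]] .
  then have "((\<lambda>x. x) has_derivative (\<lambda>v. D\<psi> (\<phi> x) (D\<phi> x v))) (at x)"
    by (rule has_derivative_transform_within_open[OF _ open_sets(1) x]) (simp add: maps)
  from has_derivative_unique[OF this has_derivative_ident]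
  show "D\<psi> (\<phi> x) (D\<phi> x v) = v" by metis
  let ?y = "\<phi> x"
  have y: "?y \<in> V" "\<psi> ?y = x" using x maps by auto
  have "((\<lambda>y. \<phi> (\<psi> y)) has_derivative (\<lambda>v. D\<phi> (\<psi> ?y) (D\<psi> ?y v))) (at ?y)"
    using x y by (intro has_derivative_compose[OF D\<psi>] D\<phi>) auto
  then have "((\<lambda>y. y) has_derivative (\<lambda>v. D\<phi> (\<psi> ?y) (D\<psi> ?y v))) (at ?y)"
    by (rule has_derivative_transform_within_open[OF _ open_sets(2) y(1)]) (simp add: maps)
  from has_derivative_unique[OF this has_derivative_ident]
  show "D\<phi> x (D\<psi> ?y v) = v" using y by metis
qed

section \<open>Coordinate curves, tangent spaces and frames\<close>

text \<open>Straight segments in \<open>L\<close>, carried back by \<psi>, are the two-sided test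
  curves in \<open>S\<close> used both for the tangent space and for the second variation.\<close>

lemma slice_curve:
  assumes q: "q \<in> U \<inter> S" and l: "l \<in> L"
  shows "\<exists>\<epsilon>>0. \<forall>t. \<bar>t\<bar> < \<epsilon> \<longrightarrow> \<psi> (\<phi> q + t *\<^sub>R l) \<in> U \<inter> S \<and>
      ((\<lambda>t. \<psi> (\<phi> q + t *\<^sub>R l)) has_vector_derivative D\<psi> (\<phi> q + t *\<^sub>R l) l) (at t)"
proof -
  obtain e where e: "0 < e" "ball (\<phi> q) e \<subseteq> V"
    using open_sets(2) maps(1)[of q] q by (meson IntD1 open_contains_ball)
  \<comment> \<open>Adding 1 to the norm covers the case \<open>l = 0\<close>.\<close>
  define \<epsilon> where "\<epsilon> = e / (norm l + 1)"
  have "0 < \<epsilon>" using e by (auto simp: \<epsilon>_def intro!: divide_pos_pos add_nonneg_pos)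
  moreover have V: "\<phi> q + t *\<^sub>R l \<in> V" if "\<bar>t\<bar> < \<epsilon>" for t
  proof -
    have "\<bar>t\<bar> * norm l \<le> \<bar>t\<bar> * (norm l + 1)" by (intro mult_left_mono) auto
    also have "\<dots> < e"
      using that by (simp add: \<epsilon>_def pos_less_divide_eq add_nonneg_pos)
    finally show ?thesis using e(2) by (auto simp: dist_norm)
  qed
  moreover have "\<psi> (\<phi> q + t *\<^sub>R l) \<in> U \<inter> S" if "\<bar>t\<bar> < \<epsilon>" for t
    using V[OF that] q l subspace_L maps mem_iff by (auto intro!: subspace_add subspace_scale)
  moreover have "((\<lambda>t. \<psi> (\<phi> q + t *\<^sub>R l)) has_vector_derivative D\<psi> (\<phi> q + t *\<^sub>R l) l) (at t)"
    if "\<bar>t\<bar> < \<epsilon>" for t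
    unfolding has_vector_derivative_def
  proof -
    have 1: "((\<lambda>t. \<phi> q + t *\<^sub>R l) has_derivative (\<lambda>s. s *\<^sub>R l)) (at t)"
      by (auto intro!: derivative_eq_intros)
    have 2: "(\<psi> has_derivative D\<psi> (\<phi> q + t *\<^sub>R l)) (at (\<phi> q + t *\<^sub>R l))"
      by (rule D\<psi>[OF V[OF that]])
    have 3: "(\<lambda>s. D\<psi> (\<phi> q + t *\<^sub>R l) (s *\<^sub>R l)) = (\<lambda>s. s *\<^sub>R D\<psi> (\<phi> q + t *\<^sub>R l) l)"
      using linear_scale[OF linear_D(2)[OF V[OF that]]] by blast
    show "((\<lambda>t. \<psi> (\<phi> q + t *\<^sub>R l)) has_derivative (\<lambda>s. s *\<^sub>R D\<psi> (\<phi> q + t *\<^sub>R l) l)) (at t)"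
      by (rule has_derivative_eq_rhs[OF has_derivative_compose[of "\<lambda>t. \<phi> q + t *\<^sub>R l", OF 1 2] 3])
  qed
  ultimately show ?thesis by blast
qed

lemma slice_curve_second_derivative:
  assumes "q \<in> U"
  shows "((\<lambda>t. D\<psi> (\<phi> q + t *\<^sub>R l) l) has_vector_derivative hess (\<phi> q) l l) (at 0)"
proof -
  have y: "\<phi> q + 0 *\<^sub>R l \<in> V" using assms maps by simp
  have b: "((\<lambda>t. D\<psi> (\<phi> q + t *\<^sub>R l) b) has_derivative
      (\<lambda>s. frechet_derivative (\<lambda>y. D\<psi> y b) (at (\<phi> q)) (s *\<^sub>R l))) (at 0)" for b
    using y by (intro has_derivative_compose[OF _ D2\<psi>, THEN has_derivative_eq_rhs])
      (auto intro!: derivative_eq_intros)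
  have "((\<lambda>t. \<Sum>b\<in>Basis. (l \<bullet> b) *\<^sub>R D\<psi> (\<phi> q + t *\<^sub>R l) b) has_derivative
      (\<lambda>s. \<Sum>b\<in>Basis. (l \<bullet> b) *\<^sub>R frechet_derivative (\<lambda>y. D\<psi> y b) (at (\<phi> q)) (s *\<^sub>R l))) (at 0)"
    by (intro has_derivative_sum has_derivative_scaleR_right b)
  moreover have "(\<Sum>b\<in>Basis. (l \<bullet> b) *\<^sub>R frechet_derivative (\<lambda>y. D\<psi> y b) (at (\<phi> q)) (s *\<^sub>R l)) =
      s *\<^sub>R hess (\<phi> q) l l" for s
    using linear_scale[OF has_derivative_linear[OF D2\<psi>]] maps(1)[OF assms]
    by (simp add: hess_def scaleR_sum_right mult.commute)
  ultimately have "((\<lambda>t. \<Sum>b\<in>Basis. (l \<bullet> b) *\<^sub>R D\<psi> (\<phi> q + t *\<^sub>R l) b) has_vector_derivative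
      hess (\<phi> q) l l) (at 0)"
    unfolding has_vector_derivative_def by simp
  moreover have "open ((\<lambda>t. \<phi> q + t *\<^sub>R l) -` V)"
    by (intro open_vimage open_sets continuous_intros)
  ultimately show ?thesis
  proof (rule has_vector_derivative_transform_within_open)
    show "0 \<in> (\<lambda>t. \<phi> q + t *\<^sub>R l) -` V" using y by simp
    fix t assume "t \<in> (\<lambda>t. \<phi> q + t *\<^sub>R l) -` V"
    then show "(\<Sum>b\<in>Basis. (l \<bullet> b) *\<^sub>R D\<psi> (\<phi> q + t *\<^sub>R l) b) = D\<psi> (\<phi> q + t *\<^sub>R l) l"
      using linear_eq_sum_Basis[OF linear_D(2), of "\<phi> q + t *\<^sub>R l" l] by simp
  qed
qed

text \<open>A curve in \<open>S\<close> is mapped by \<phi> into \<open>L\<close>, so its image has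
  velocity in \<open>L\<close>. Conversely the slice curve in direction \<open>D\<phi> q v\<close>
  has velocity \<open>v\<close>, so near an interior point the span in the definition adds
  nothing.\<close>

lemma tangent_space_eq:
  assumes q: "q \<in> U \<inter> S"
  shows "tangent_space S q = {v. D\<phi> q v \<in> L}"
proof -
  have qU: "q \<in> U" using q by simp
  have sub: "subspace {v. D\<phi> q v \<in> L}"
    using linear_subspace_vimage[OF linear_D(1)[OF qU] subspace_L] by (simp add: vimage_def)
  show ?thesis unfolding tangent_space_def
  proof (rule antisym, rule span_minimal[OF _ sub])
    show "{v. \<exists>\<gamma> \<epsilon>. 0 < \<epsilon> \<and> \<gamma> 0 = q \<and> \<gamma> ` {0..<\<epsilon>} \<subseteq> S \<and>
        (\<gamma> has_vector_derivative v) (at 0 within {0..<\<epsilon>})} \<subseteq> {v. D\<phi> q v \<in> L}"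
    proof
      fix v assume "v \<in> {v. \<exists>\<gamma> \<epsilon>. 0 < \<epsilon> \<and> \<gamma> 0 = q \<and> \<gamma> ` {0..<\<epsilon>} \<subseteq> S \<and>
        (\<gamma> has_vector_derivative v) (at 0 within {0..<\<epsilon>})}"
      then obtain \<gamma> and \<epsilon> :: real where \<gamma>: "0 < \<epsilon>" "\<gamma> 0 = q" "\<gamma> ` {0..<\<epsilon>} \<subseteq> S"
        "(\<gamma> has_vector_derivative v) (at 0 within {0..<\<epsilon>})"
        by blast
      have "((\<phi> \<circ> \<gamma>) has_vector_derivative D\<phi> q v) (at 0 within {0..<\<epsilon>})"
        by (rule vector_derivative_diff_chain_within[OF \<gamma>(4)])
          (use D\<phi>[OF qU] \<gamma>(2) in \<open>simp add: has_derivative_at_withinI\<close>)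
      then have "D\<phi> q v \<in> L"
      proof (rule has_vector_derivative_in_subspace[OF subspace_L])
        show "at 0 within {0..<\<epsilon>} \<noteq> bot"
          using \<gamma>(1) by (simp add: trivial_limit_within islimpt_Ico)
        show "(\<phi> \<circ> \<gamma>) 0 \<in> L" using q \<gamma>(2) mem_iff by auto
        have "(\<gamma> \<longlongrightarrow> q) (at 0 within {0..<\<epsilon>})"
          using has_vector_derivative_continuous[OF \<gamma>(4)] \<gamma>(2) by (simp add: continuous_within)
        then have "\<forall>\<^sub>F t in at 0 within {0..<\<epsilon>}. \<gamma> t \<in> U"
          using open_sets(1) qU by (rule topological_tendstoD)
        moreover have "\<forall>\<^sub>F t in at 0 within {0..<\<epsilon>}. \<gamma> t \<in> S"
          using \<gamma>(3) by (auto simp: eventually_at_filter intro!: always_eventually)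
        ultimately show "\<forall>\<^sub>F t in at 0 within {0..<\<epsilon>}. (\<phi> \<circ> \<gamma>) t \<in> L"
          by eventually_elim (use mem_iff in auto)
      qed
      then show "v \<in> {v. D\<phi> q v \<in> L}" by simp
    qed
    show "{v. D\<phi> q v \<in> L} \<subseteq> span {v. \<exists>\<gamma> \<epsilon>. 0 < \<epsilon> \<and> \<gamma> 0 = q \<and> \<gamma> ` {0..<\<epsilon>} \<subseteq> S \<and>
        (\<gamma> has_vector_derivative v) (at 0 within {0..<\<epsilon>})}"
    proof (intro subsetI span_base CollectI)
      fix v assume "v \<in> {v. D\<phi> q v \<in> L}"
      then have l: "D\<phi> q v \<in> L" by simp
      obtain \<epsilon> where \<epsilon>: "0 < \<epsilon>" "\<forall>t. \<bar>t\<bar> < \<epsilon> \<longrightarrow> \<psi> (\<phi> q + t *\<^sub>R D\<phi> q v) \<in> U \<inter> S \<and>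
        ((\<lambda>t. \<psi> (\<phi> q + t *\<^sub>R D\<phi> q v)) has_vector_derivative
          D\<psi> (\<phi> q + t *\<^sub>R D\<phi> q v) (D\<phi> q v)) (at t)"
        using slice_curve[OF q l] by blast
      show "\<exists>\<gamma> \<epsilon>. 0 < \<epsilon> \<and> \<gamma> 0 = q \<and> \<gamma> ` {0..<\<epsilon>} \<subseteq> S \<and>
        (\<gamma> has_vector_derivative v) (at 0 within {0..<\<epsilon>})"
        using \<epsilon> \<epsilon>(2)[rule_format, of 0] maps(3)[OF qU] inverse_D(1)[OF qU, of v]
        by (intro exI[of _ "\<lambda>t. \<psi> (\<phi> q + t *\<^sub>R D\<phi> q v)"] exI[of _ \<epsilon>])
          (auto intro: has_vector_derivative_at_within)
    qed
  qed
qed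

lemma dim_tangent_space:
  assumes q: "q \<in> U \<inter> S"
  shows "dim (tangent_space S q) = n"
proof -
  have qU: "q \<in> U" using q by simp
  have "tangent_space S q = D\<psi> (\<phi> q) ` L"
    unfolding tangent_space_eq[OF q]
    using inverse_D[OF qU] by (auto simp: image_iff) metis
  moreover have "dim (D\<psi> (\<phi> q) ` L) = dim L"
    by (intro dim_image_eq linear_D(2) maps(1) qU inj_on_inverseI) (rule inverse_D(2)[OF qU])
  ultimately show ?thesis using dim_L by simp
qed

text \<open>The fields \<open>D\<psi> (\<phi> q) c\<close> with \<open>c\<close> in a basis of
  \<open>L\<close> are smooth and independent on all of \<open>U\<close> and tangent along
  \<open>S\<close>; Gram-Schmidt keeps their span.\<close>

lemma orthonormal_frame_exists: "\<exists>f. orthonormal_tangent_frame n S U f"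
proof -
  obtain B where B: "B \<subseteq> L" "independent B" "card B = n"
    using basis_exists[of L] dim_L by metis
  obtain c :: "nat \<Rightarrow> 'a" where c: "bij_betw c {..<n} B"
    using ex_bij_betw_nat_finite[OF finiteI_independent[OF B(2)]] B(3) by (auto simp: atLeast0LessThan)
  have cL: "c i \<in> L" if "i < n" for i using bij_betwE[OF c] B(1) that by auto
  define E where "E = (\<lambda>i q. D\<psi> (\<phi> q) (c i))"
  have "smooth_on U (E i)" for i
    unfolding E_def smooth_on_def
  proof (intro conjI allI open_sets)
    fix k
    have 1: "Ck_on k V (\<lambda>y. D\<psi> y (c i))" using smooth(2)[of "Suc k"] by simp
    show "Ck_on k U (\<lambda>q. D\<psi> (\<phi> q) (c i))"
      by (rule Ck_on_compose[OF open_sets _ 1 smooth(1)]) (use maps in auto)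
  qed
  moreover have "E i q \<notin> span ((\<lambda>j. E j q) ` {..<i})" if "i < n" "q \<in> U" for i q
  proof
    assume "E i q \<in> span ((\<lambda>j. E j q) ` {..<i})"
    also have "(\<lambda>j. E j q) ` {..<i} = D\<psi> (\<phi> q) ` (c ` {..<i})" by (auto simp: E_def)
    also have "span \<dots> = D\<psi> (\<phi> q) ` span (c ` {..<i})"
      using linear_span_image[OF linear_D(2)] maps(1) that by blast
    finally obtain z where z: "z \<in> span (c ` {..<i})" "D\<psi> (\<phi> q) (c i) = D\<psi> (\<phi> q) z"
      by (auto simp: E_def)
    then have "c i = z" using inverse_D(2)[OF that(2)] by metis
    moreover have "c ` {..<i} \<subseteq> B - {c i}"
      using c that by (auto simp: bij_betw_def inj_on_def)
    ultimately have "c i \<in> span (B - {c i})" using z(1) span_mono by blast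
    moreover have "c i \<in> B" using c that by (auto simp: bij_betw_def)
    ultimately show False using B(2) dependent_def by blast
  qed
  ultimately obtain f where f: "\<forall>i<n. smooth_on U (f i)"
    "\<forall>q\<in>U. \<forall>i<n. f i q \<in> span ((\<lambda>j. E j q) ` {..<n}) \<and>
        (\<forall>j<n. f i q \<bullet> f j q = (if i = j then 1 else 0))"
    using smooth_gram_schmidt[OF open_sets(1), of n E] by blast
  have "span ((\<lambda>j. E j q) ` {..<n}) \<subseteq> tangent_space S q" if "q \<in> U \<inter> S" for q
  proof (rule span_minimal)
    show "(\<lambda>j. E j q) ` {..<n} \<subseteq> tangent_space S q"
      using that cL inverse_D(2) unfolding tangent_space_eq[OF that] by (auto simp: E_def)
    show "subspace (tangent_space S q)" by (simp add: tangent_space_def)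
  qed
  then show ?thesis
    using f unfolding orthonormal_tangent_frame_def by blast
qed

text \<open>Along \<open>S\<close> a tangent field is \<open>f = D\<psi>(\<phi>) M\<close> with \<open>M\<close> valued in the linear space \<open>L\<close>. In the
  product rule for \<open>D\<^sub>v f\<close> the term with the derivative of \<open>M\<close> is tangent.\<close>

lemma derivative_tangent_field:
  assumes p: "p \<in> U \<inter> S" "open U'" "p \<in> U'" and f: "f differentiable at p"
    and tan: "\<And>q. q \<in> U' \<inter> S \<Longrightarrow> f q \<in> tangent_space S q" and v: "v \<in> tangent_space S p"
  shows "frechet_derivative f (at p) v - hess (\<phi> p) (D\<phi> p v) (D\<phi> p (f p)) \<in> tangent_space S p"
proof -
  have pU: "p \<in> U" using p by simp
  \<comment> \<open>On \<open>U\<close> this is \<open>D\<phi> x (f x)\<close>; as a sum over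
    \<open>Basis\<close> it can be differentiated term by term.\<close>
  define M where "M = (\<lambda>x. \<Sum>b\<in>Basis. (f x \<bullet> b) *\<^sub>R D\<phi> x b)"
  have M: "M x = D\<phi> x (f x)" if "x \<in> U" for x
    unfolding M_def using linear_eq_sum_Basis[OF linear_D(1)[OF that]] by metis
  have df: "(f has_derivative frechet_derivative f (at p)) (at p)"
    using f by (simp add: frechet_derivative_works)
  have "(M has_derivative (\<lambda>v. \<Sum>b\<in>Basis.
      (f p \<bullet> b) *\<^sub>R frechet_derivative (\<lambda>x. D\<phi> x b) (at p) v +
      (frechet_derivative f (at p) v \<bullet> b) *\<^sub>R D\<phi> p b)) (at p)"
    unfolding M_def by (intro has_derivative_sum has_derivative_scaleR
        has_derivative_inner_left df D2\<phi>[OF pU])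
  then obtain M' where M': "(M has_derivative M') (at p)" by blast
  have b: "((\<lambda>x. D\<psi> (\<phi> x) b) has_derivative
      (\<lambda>v. frechet_derivative (\<lambda>y. D\<psi> y b) (at (\<phi> p)) (D\<phi> p v))) (at p)" for b
    using has_derivative_compose[OF D\<phi>[OF pU] D2\<psi>[OF maps(1)[OF pU]]] .
  have "((\<lambda>x. \<Sum>b\<in>Basis. (M x \<bullet> b) *\<^sub>R D\<psi> (\<phi> x) b) has_derivative
      (\<lambda>v. \<Sum>b\<in>Basis. (M p \<bullet> b) *\<^sub>R frechet_derivative (\<lambda>y. D\<psi> y b) (at (\<phi> p)) (D\<phi> p v) +
        (M' v \<bullet> b) *\<^sub>R D\<psi> (\<phi> p) b)) (at p)"
    by (intro has_derivative_sum has_derivative_scaleR has_derivative_inner_left M' b)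
  then have "(f has_derivative
      (\<lambda>v. \<Sum>b\<in>Basis. (M p \<bullet> b) *\<^sub>R frechet_derivative (\<lambda>y. D\<psi> y b) (at (\<phi> p)) (D\<phi> p v) +
        (M' v \<bullet> b) *\<^sub>R D\<psi> (\<phi> p) b)) (at p)"
  proof (rule has_derivative_transform_within_open[OF _ open_sets(1) pU])
    fix x assume x: "x \<in> U"
    show "(\<Sum>b\<in>Basis. (M x \<bullet> b) *\<^sub>R D\<psi> (\<phi> x) b) = f x"
      using linear_eq_sum_Basis[OF linear_D(2)[OF maps(1)[OF x]], of "M x"] M[OF x] inverse_D(1)[OF x]
      by simp
  qed
  from has_derivative_unique[OF df this]
  have "frechet_derivative f (at p) v = hess (\<phi> p) (D\<phi> p v) (M p) + (\<Sum>b\<in>Basis. (M' v \<bullet> b) *\<^sub>R D\<psi> (\<phi> p) b)"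
    by (simp add: sum.distrib hess_def)
  also have "(\<Sum>b\<in>Basis. (M' v \<bullet> b) *\<^sub>R D\<psi> (\<phi> p) b) = D\<psi> (\<phi> p) (M' v)"
    using linear_eq_sum_Basis[OF linear_D(2)[OF maps(1)[OF pU]]] by metis
  finally have eq: "frechet_derivative f (at p) v - hess (\<phi> p) (D\<phi> p v) (D\<phi> p (f p)) = D\<psi> (\<phi> p) (M' v)"
    using M[OF pU] by simp
  have l: "D\<phi> p v \<in> L" using v tangent_space_eq[OF p(1)] by auto
  obtain \<epsilon> where \<epsilon>: "0 < \<epsilon>" "\<forall>t. \<bar>t\<bar> < \<epsilon> \<longrightarrow> \<psi> (\<phi> p + t *\<^sub>R D\<phi> p v) \<in> U \<inter> S \<and>
    ((\<lambda>t. \<psi> (\<phi> p + t *\<^sub>R D\<phi> p v)) has_vector_derivative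
        D\<psi> (\<phi> p + t *\<^sub>R D\<phi> p v) (D\<phi> p v)) (at t)"
    using slice_curve[OF p(1) l] by blast
  define \<gamma> where "\<gamma> = (\<lambda>t. \<psi> (\<phi> p + t *\<^sub>R D\<phi> p v))"
  have \<gamma>_0: "\<gamma> 0 = p" using maps(3)[OF pU] by (simp add: \<gamma>_def)
  have d\<gamma>: "(\<gamma> has_vector_derivative v) (at 0)"
    using \<epsilon>(2)[rule_format, of 0] \<epsilon>(1) inverse_D(1)[OF pU] by (simp add: \<gamma>_def)
  have M_in_L: "M x \<in> L" if "x \<in> U" "x \<in> S" "x \<in> U'" for x
    using tan[of x] tangent_space_eq[of x] M[of x] that by auto
  \<comment> \<open>\<open>M\<close> takes values in \<open>L\<close> only along \<open>S\<close>,
    so its derivative is taken along a curve in \<open>S\<close> with velocity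
    \<open>v\<close>.\<close>
  have "M' v \<in> L"
  proof (rule has_vector_derivative_in_subspace[OF subspace_L])
    show "((M \<circ> \<gamma>) has_vector_derivative M' v) (at 0)"
      using vector_derivative_diff_chain_within[of \<gamma> v 0 UNIV M M'] d\<gamma> M' \<gamma>_0
      by (auto intro: has_derivative_at_withinI)
    show "(M \<circ> \<gamma>) 0 \<in> L" using M_in_L p pU \<gamma>_0 by auto
    have "(\<gamma> \<longlongrightarrow> p) (at 0)"
      using has_vector_derivative_continuous[OF d\<gamma>] \<gamma>_0 by (simp add: continuous_within)
    then have "\<forall>\<^sub>F t in at 0. \<gamma> t \<in> U'"
      using p by (intro topological_tendstoD)
    moreover have "\<forall>\<^sub>F t in at 0. \<gamma> t \<in> U \<inter> S"
      unfolding eventually_at using \<epsilon> by (intro exI[of _ \<epsilon>]) (auto simp: \<gamma>_def dist_norm)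
    ultimately show "\<forall>\<^sub>F t in at 0. (M \<circ> \<gamma>) t \<in> L"
      by eventually_elim (use M_in_L in auto)
  qed simp
  then show ?thesis
    unfolding eq using tangent_space_eq[OF p(1)] inverse_D(2)[OF pU] by simp
qed

section \<open>Second fundamental form and mean curvature in the chart\<close>

text \<open>The normal projection removes the tangent difference between the derivative of the field
  and \<open>hess\<close>, leaving a form that depends only on the value of the field at
  \<open>p\<close>.\<close>

lemma second_fundamental_form_eq:
  assumes p: "p \<in> U \<inter> S" "open U'" "p \<in> U'" and f: "orthonormal_tangent_frame n S U' f" and "i < n"
  shows "second_fundamental_form S (f i) (f i) p = normal_part S p (hess (\<phi> p) (D\<phi> p (f i p)) (D\<phi> p (f i p)))"
proof -
  have "smooth_on U' (f i)"
    using f \<open>i < n\<close> by (simp add: orthonormal_tangent_frame_def)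
  then have "Ck_on (Suc 0) U' (f i)" unfolding smooth_on_def by blast
  then have "f i differentiable at p" using p(3) by simp
  then have "frechet_derivative (f i) (at p) (f i p) - hess (\<phi> p) (D\<phi> p (f i p)) (D\<phi> p (f i p))
      \<in> tangent_space S p"
    using f \<open>i < n\<close> p by (intro derivative_tangent_field[OF p])
      (auto simp: orthonormal_tangent_frame_def)
  from normal_part_tangent[OF this] show ?thesis
    by (simp add: second_fundamental_form_def linear_diff[OF linear_normal_part])
qed

lemma bilinear_hess:
  assumes p: "p \<in> U"
  shows "bilinear (\<lambda>v w. normal_part S p (hess (\<phi> p) (D\<phi> p v) (D\<phi> p w)))"
proof -
  have 1: "linear (\<lambda>l. hess (\<phi> p) l m)" for m
    unfolding hess_def using has_derivative_linear[OF D2\<psi>[OF maps(1)[OF p]]]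
    by (intro linear_compose_sum ballI linear_compose_scale_right)
  have 2: "linear (\<lambda>m. hess (\<phi> p) l m)" for l
    unfolding hess_def
    by (intro linearI) (simp_all add: inner_add_left scaleR_add_left sum.distrib scaleR_sum_right)
  show ?thesis
    unfolding bilinear_def
    using linear_compose[OF linear_D(1)[OF p] linear_compose[OF 1 linear_normal_part]]
      linear_compose[OF linear_D(1)[OF p] linear_compose[OF 2 linear_normal_part]]
    by (auto simp: o_def)
qed

text \<open>As \<open>mean_curvature\<close> is a definite description, its value is known only because a frame exists
  and the trace of the bilinear form does not depend on it.\<close>

lemma mean_curvature_eq:
  assumes p: "p \<in> U \<inter> S" and f: "orthonormal_tangent_frame n S U f"
  shows "mean_curvature n S p = - (\<Sum>i<n. normal_part S p (hess (\<phi> p) (D\<phi> p (f i p)) (D\<phi> p (f i p))))"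
  unfolding mean_curvature_def
proof (rule the_equality)
  let ?B = "\<lambda>v w. normal_part S p (hess (\<phi> p) (D\<phi> p v) (D\<phi> p w))"
  have sff: "(\<Sum>i<n. second_fundamental_form S (g i) (g i) p) = (\<Sum>i<n. ?B (g i p) (g i p))"
    if "open U'" "p \<in> U'" "orthonormal_tangent_frame n S U' g" for U' g
    using second_fundamental_form_eq[OF p that] by (intro sum.cong) auto
  show "\<exists>U' g. open U' \<and> p \<in> U' \<and> orthonormal_tangent_frame n S U' g \<and>
      - (\<Sum>i<n. ?B (f i p) (f i p)) = - (\<Sum>i<n. second_fundamental_form S (g i) (g i) p)"
    using sff[OF open_sets(1) _ f] p f open_sets(1) by (intro exI[of _ U] exI[of _ f]) simp
  fix h assume "\<exists>U' g. open U' \<and> p \<in> U' \<and> orthonormal_tangent_frame n S U' g \<and>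
      h = - (\<Sum>i<n. second_fundamental_form S (g i) (g i) p)"
  then obtain U' g where g: "open U'" "p \<in> U'" "orthonormal_tangent_frame n S U' g"
    and h: "h = - (\<Sum>i<n. ?B (g i p) (g i p))" using sff by auto
  have "(\<Sum>i<n. ?B (g i p) (g i p)) = (\<Sum>i<n. ?B (f i p) (f i p))"
  proof (rule bilinear_trace_eq[where f = "\<lambda>i. g i p" and g = "\<lambda>i. f i p",
        OF bilinear_hess _ dim_tangent_space[OF p]])
    show "p \<in> U" "subspace (tangent_space S p)" using p by (simp_all add: tangent_space_def)
  qed (use p g(2,3) f in \<open>simp_all add: orthonormal_tangent_frame_def\<close>)
  then show "h = - (\<Sum>i<n. ?B (f i p) (f i p))" using h by simp
qed

end

section \<open>The maximum principle on a shrinker\<close>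

lemma interior_point_slice_chart:
  assumes "interior_point n S p"
  shows "\<exists>U V L \<phi> \<psi>. p \<in> U \<and> slice_chart n S U V L \<phi> \<psi>"
  using assms unfolding interior_point_def slice_chart_def
  by (elim exE conjE) (intro exI conjI; assumption)

text \<open>Here \<open>g\<close> is the gradient of \<open>F\<close> and \<open>G\<close> its
  Hessian at \<open>p\<close>. Along slice curves the first derivative vanishes and the second is
  \<open>G v \<bullet> v + g p \<bullet> hess\<close>. Summed over an orthonormal tangent frame, the
  \<open>hess\<close> terms give \<open>- g p \<bullet> H\<close>, which the shrinker equation turns
  into \<open>- (g p \<bullet> p) / 2\<close>. The result says that the drift Laplacian of
  \<open>F\<close> is nonnegative at a local minimum.\<close>

lemma shrinker_second_variation:
  fixes S :: "'a::euclidean_space set" and F :: "'a \<Rightarrow> real" and g G :: "'a \<Rightarrow> 'a"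
  assumes "shrinker n S" "p \<in> S" "interior_point n S p" and N: "open N" "p \<in> N"
    and min: "\<And>q. q \<in> S \<inter> N \<Longrightarrow> F p \<le> F q"
    and dF: "\<And>x. x \<in> N \<Longrightarrow> (F has_derivative (\<lambda>v. g x \<bullet> v)) (at x)"
    and dg: "(g has_derivative G) (at p)"
  shows "\<exists>f. (\<forall>i<n. \<forall>j<n. f i \<bullet> f j = (if i = j then 1 else 0)) \<and>
    0 \<le> (\<Sum>i<n. G (f i) \<bullet> f i) - (g p \<bullet> p) / 2"
proof -
  obtain U V L \<phi> \<psi> where "p \<in> U" and chart: "slice_chart n S U V L \<phi> \<psi>"
    using interior_point_slice_chart[OF assms(3)] by blast
  interpret slice_chart n S U V L \<phi> \<psi> by (rule chart)
  have p: "p \<in> U \<inter> S" and pU: "p \<in> U" using \<open>p \<in> U\<close> \<open>p \<in> S\<close> by auto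
  let ?T = "tangent_space S p" and ?H = "\<lambda>v. hess (\<phi> p) (D\<phi> p v) (D\<phi> p v)"
  have var: "g p \<bullet> v = 0" "0 \<le> G v \<bullet> v + g p \<bullet> ?H v" if "v \<in> ?T" for v
  proof -
    let ?l = "D\<phi> p v"
    define \<gamma> where "\<gamma> = (\<lambda>t. \<psi> (\<phi> p + t *\<^sub>R ?l))"
    define \<gamma>d where "\<gamma>d = (\<lambda>t. D\<psi> (\<phi> p + t *\<^sub>R ?l) ?l)"
    have l: "?l \<in> L" using that tangent_space_eq[OF p] by auto
    obtain \<epsilon> where \<epsilon>: "0 < \<epsilon>" "\<And>t. \<bar>t\<bar> < \<epsilon> \<Longrightarrow> \<gamma> t \<in> S"
      "\<And>t. \<bar>t\<bar> < \<epsilon> \<Longrightarrow> (\<gamma> has_vector_derivative \<gamma>d t) (at t)"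
      using slice_curve[OF p l] unfolding \<gamma>_def \<gamma>d_def by blast
    have at0: "\<gamma> 0 = p" "\<gamma>d 0 = v"
      using maps(3)[OF pU] inverse_D(1)[OF pU] by (simp_all add: \<gamma>_def \<gamma>d_def)
    have d0: "(\<gamma> has_vector_derivative v) (at 0)" using \<epsilon>(3)[of 0] \<epsilon>(1) at0 by simp
    have "(\<gamma> \<longlongrightarrow> p) (at 0)"
      using has_vector_derivative_continuous[OF d0] at0 by (simp add: continuous_within)
    then have "\<forall>\<^sub>F t in at 0. \<gamma> t \<in> N"
      using N by (rule topological_tendstoD)
    then obtain \<delta> where \<delta>: "0 < \<delta>" "\<And>t. t \<noteq> 0 \<Longrightarrow> \<bar>t\<bar> < \<delta> \<Longrightarrow> \<gamma> t \<in> N"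
      unfolding eventually_at by (auto simp: dist_norm)
    \<comment> \<open>For these parameters the curve stays in \<open>S\<close> and in the
      neighbourhood \<open>N\<close> where \<open>p\<close> is a minimum.\<close>
    define \<eta> where "\<eta> = min \<epsilon> \<delta>"
    have \<eta>: "0 < \<eta>" "\<And>t. \<bar>t\<bar> < \<eta> \<Longrightarrow> \<gamma> t \<in> S \<inter> N \<and> \<bar>t\<bar> < \<epsilon>"
      using \<epsilon> \<delta> at0 N(2) \<open>p \<in> S\<close> by (auto simp: \<eta>_def) metis
    have 1: "((\<lambda>t. F (\<gamma> t)) has_real_derivative g (\<gamma> t) \<bullet> \<gamma>d t) (at t)" if t: "\<bar>t\<bar> < \<eta>" for t
    proof -
      have "(\<gamma> has_derivative (\<lambda>s. s *\<^sub>R \<gamma>d t)) (at t)"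
        using \<epsilon>(3) \<eta>(2)[OF t] by (simp add: has_vector_derivative_def)
      moreover have "(F has_derivative (\<lambda>v. g (\<gamma> t) \<bullet> v)) (at (\<gamma> t))"
        using \<eta>(2)[OF t] by (intro dF) auto
      ultimately have "((\<lambda>t. F (\<gamma> t)) has_derivative (\<lambda>s. g (\<gamma> t) \<bullet> (s *\<^sub>R \<gamma>d t))) (at t)"
        by (rule has_derivative_compose)
      then show ?thesis
        unfolding has_field_derivative_def by (rule has_derivative_eq_rhs) (auto simp: mult.commute)
    qed
    have dg': "(g has_derivative G) (at (\<gamma> 0))" using dg at0 by simp
    have "((\<lambda>t. g (\<gamma> t)) has_derivative (\<lambda>s. G (s *\<^sub>R v))) (at 0)"
      using has_derivative_compose[OF d0[unfolded has_vector_derivative_def] dg'] .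
    moreover have "(\<gamma>d has_derivative (\<lambda>s. s *\<^sub>R ?H v)) (at 0)"
      using slice_curve_second_derivative[OF pU, of ?l]
      by (simp add: has_vector_derivative_def \<gamma>d_def)
    ultimately have "((\<lambda>t. g (\<gamma> t) \<bullet> \<gamma>d t) has_derivative
        (\<lambda>s. g (\<gamma> 0) \<bullet> (s *\<^sub>R ?H v) + G (s *\<^sub>R v) \<bullet> \<gamma>d 0)) (at 0)"
      by (rule has_derivative_inner)
    then have 2: "((\<lambda>t. g (\<gamma> t) \<bullet> \<gamma>d t) has_real_derivative G v \<bullet> v + g p \<bullet> ?H v) (at 0)"
      unfolding has_field_derivative_def
      by (rule has_derivative_eq_rhs)
        (auto simp: at0 linear_scale[OF has_derivative_linear[OF dg]] algebra_simps)
    have 3: "F (\<gamma> 0) \<le> F (\<gamma> t)" if "\<bar>t\<bar> < \<eta>" for t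
      using \<eta>(2)[OF that] min at0 by simp
    show "g p \<bullet> v = 0" "0 \<le> G v \<bullet> v + g p \<bullet> ?H v"
      using second_derivative_at_min[OF \<eta>(1) 1 2 3] at0 by simp_all
  qed
  have normal: "g p \<bullet> normal_part S p z = g p \<bullet> z" for z
    using var(1)[OF normal_part_decomposition(2), of z] by (simp add: inner_diff_right)
  obtain f where f: "orthonormal_tangent_frame n S U f" using orthonormal_frame_exists by blast
  have "(\<Sum>i<n. g p \<bullet> ?H (f i p)) = g p \<bullet> (\<Sum>i<n. normal_part S p (?H (f i p)))"
    by (simp add: inner_sum_right normal)
  also have "\<dots> = - (g p \<bullet> mean_curvature n S p)"
    using mean_curvature_eq[OF p f] by simp
  also have "mean_curvature n S p = (1/2) *\<^sub>R normal_part S p p"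
    using assms(1,2) unfolding shrinker_def by blast
  finally have H: "(\<Sum>i<n. g p \<bullet> ?H (f i p)) = - (g p \<bullet> p) / 2"
    by (simp add: normal)
  have "0 \<le> (\<Sum>i<n. G (f i p) \<bullet> f i p + g p \<bullet> ?H (f i p))"
    using f p unfolding orthonormal_tangent_frame_def by (intro sum_nonneg var(2)) auto
  then show ?thesis
    using f p H unfolding orthonormal_tangent_frame_def
    by (intro exI[of _ "\<lambda>i. f i p"]) (simp add: sum.distrib)
qed

section \<open>Projections and touching functions\<close>

lemma orthogonal_projection_exists:
  fixes W :: "'a::euclidean_space set"
  assumes W: "subspace W"
  obtains P where "linear P" "\<And>x. P x \<in> W" "\<And>x. x - P x \<in> orthogonal_comp W"
    "\<And>x y. P x \<bullet> y = x \<bullet> P y" "\<And>x. P (P x) = P x" "(\<Sum>b\<in>Basis. P b \<bullet> P b) = real (dim W)"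
proof -
  obtain B where B: "B \<subseteq> W" "pairwise orthogonal B" "\<And>x. x \<in> B \<Longrightarrow> norm x = 1"
    "independent B" "card B = dim W" "span B = W"
    using orthonormal_basis_subspace[OF W] by metis
  have fin: "finite B" using B(4) finiteI_independent by blast
  define P where "P = (\<lambda>x. \<Sum>w\<in>B. (x \<bullet> w) *\<^sub>R w)"
  have lin: "linear P"
    unfolding P_def by (intro linearI)
      (simp_all add: inner_add_left scaleR_add_left sum.distrib scaleR_sum_right)
  have inW: "P x \<in> W" for x
    unfolding P_def using B(1) by (intro subspace_sum[OF W] subspace_scale[OF W]) auto
  have orthB: "orthogonal (x - P x) w" if "w \<in> B" for x w
  proof -
    have "(\<Sum>u\<in>B. (x \<bullet> u) * (u \<bullet> w)) = (\<Sum>u\<in>B. if u = w then x \<bullet> u else 0)"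
      using B(2,3) that by (intro sum.cong) (auto simp: pairwise_def orthogonal_def norm_eq_1)
    then show ?thesis
      using that fin by (simp add: P_def orthogonal_def inner_diff_left inner_sum_left)
  qed
  have orthW: "orthogonal (x - P x) w" if "w \<in> W" for x w
    using orthogonal_to_span[of w B] orthB that B(6) by blast
  have comp: "x - P x \<in> orthogonal_comp W" for x
    using orthW by (auto simp: orthogonal_comp_def orthogonal_commute)
  have sym: "P x \<bullet> y = x \<bullet> P y" for x y
    by (simp add: P_def inner_sum_left inner_sum_right mult.commute inner_commute)
  have idem: "P (P x) = P x" for x
  proof -
    have "P x - P (P x) \<in> W" using inW by (intro subspace_diff[OF W])
    from orthW[OF this, of "P x"] show ?thesis by (simp add: orthogonal_def)
  qed
  have "P b \<bullet> P b = (\<Sum>w\<in>B. (w \<bullet> b) * (w \<bullet> b))" for b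
  proof -
    have "P b \<bullet> P b = b \<bullet> P b" using sym idem by metis
    then show ?thesis by (simp add: P_def inner_sum_right inner_commute)
  qed
  \<comment> \<open>Exchanging the sums computes the trace of \<open>P\<close>: each unit vector of
    the orthonormal basis \<open>B\<close> contributes 1.\<close>
  then have "(\<Sum>b\<in>Basis. P b \<bullet> P b) = (\<Sum>w\<in>B. \<Sum>b\<in>Basis. (w \<bullet> b) * (w \<bullet> b))"
    by (simp add: sum.swap[of _ B])
  also have "\<dots> = (\<Sum>w\<in>B. 1)"
    using B(3) by (intro sum.cong) (simp_all add: euclidean_inner[symmetric] norm_eq_1)
  finally have "(\<Sum>b\<in>Basis. P b \<bullet> P b) = real (dim W)" using B(5) by simp
  then show ?thesis using that[of P] lin inW comp sym idem by blast
qed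

lemma mem_generalized_cylinder:
  assumes "P x \<in> W" "x - P x \<in> orthogonal_comp W" "norm (P x) = sqrt (2 * real k)"
  shows "x \<in> generalized_cylinder k W"
  unfolding generalized_cylinder_def using assms
  by (intro CollectI exI[of _ "P x"] exI[of _ "x - P x"]) auto

text \<open>Take \<open>p\<close> where \<open>(a\<^sup>2 - x \<bullet> x) / u x\<close> is largest
  on \<open>K\<close> and let \<mu> be the reciprocal of this maximum. The point \<open>q\<close>
  makes the maximum positive, which forces \<open>p\<close> into the open ball of radius
  \<open>a\<close>.\<close>

lemma touching_paraboloid:
  fixes K :: "'a::euclidean_space set"
  assumes "compact K" "continuous_on K u" "\<And>x. x \<in> K \<Longrightarrow> 0 < u x" and q: "q \<in> K" "norm q < a"
  shows "\<exists>p \<mu>. p \<in> K \<and> norm p < a \<and> \<mu> > 0 \<and> u p = \<mu> * (a\<^sup>2 - p \<bullet> p) \<and>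
    (\<forall>x\<in>K. \<mu> * (a\<^sup>2 - x \<bullet> x) \<le> u x)"
proof -
  have nz: "\<forall>x\<in>K. u x \<noteq> 0" using assms(3) by force
  have a: "0 < a" using q norm_ge_zero[of q] by linarith
  have iff: "0 < a\<^sup>2 - x \<bullet> x \<longleftrightarrow> norm x < a" for x :: 'a
    using a norm_lt_square[of x a] by simp
  have "continuous_on K (\<lambda>x. (a\<^sup>2 - x \<bullet> x) / u x)"
    by (intro continuous_intros assms(2) nz)
  then obtain p where p: "p \<in> K" "\<And>x. x \<in> K \<Longrightarrow> (a\<^sup>2 - x \<bullet> x) / u x \<le> (a\<^sup>2 - p \<bullet> p) / u p"
    using continuous_attains_sup[OF assms(1)] q by blast
  let ?m = "(a\<^sup>2 - p \<bullet> p) / u p"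
  have "0 < (a\<^sup>2 - q \<bullet> q) / u q" using iff q assms(3) by simp
  then have m: "0 < ?m" using p(2)[OF q(1)] by linarith
  show ?thesis
  proof (intro exI[of _ p] exI[of _ "1 / ?m"] conjI ballI)
    show "norm p < a"
      using m assms(3)[OF p(1)] unfolding iff[symmetric] by (simp add: zero_less_divide_iff)
    fix x assume x: "x \<in> K"
    have "a\<^sup>2 - x \<bullet> x \<le> ?m * u x"
      using p(2)[OF x] assms(3)[OF x] by (simp only: pos_divide_le_eq)
    then have "(a\<^sup>2 - x \<bullet> x) / ?m \<le> u x"
      using m by (simp only: pos_divide_le_eq mult.commute)
    then show "1 / ?m * (a\<^sup>2 - x \<bullet> x) \<le> u x"
      by (simp only: times_divide_eq_left mult_1)
  next
    show "u p = 1 / ?m * (a\<^sup>2 - p \<bullet> p)"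
      using m assms(3)[OF p(1)] by auto
    show "0 < 1 / ?m" by (rule divide_pos_pos[OF zero_less_one m])
  qed (rule p(1))
qed

section \<open>Maximum principle arguments inside the ball of radius \<open>R\<close>\<close>

locale embedded_shrinker =
  fixes n :: nat and S :: "'a::euclidean_space set" and R :: real
  assumes proper: "properly_embedded n S" and shrinker: "shrinker n S"
    and boundary: "manifold_boundary n S \<subseteq> sphere 0 R"
begin

text \<open>Properness of the inclusion of \<open>S\<close> supplies the compactness on which all
  extrema below rest.\<close>

lemma compact_Int:
  assumes "compact K"
  shows "compact (S \<inter> K)"
proof -
  have "compactin (top_of_set S) {x \<in> topspace (top_of_set S). x \<in> K}"
    by (rule compactin_proper_map_preimage[where Y = euclidean])
      (use proper assms in \<open>simp_all add: properly_embedded_def\<close>)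
  then have "compactin (top_of_set S) (S \<inter> K)" by (simp add: Int_def)
  then show ?thesis by (simp add: compactin_subtopology)
qed

text \<open>Boundary points have norm \<open>R\<close>, so \<open>norm p < R\<close> leaves only the
  interior charts.\<close>

lemma second_variation:
  assumes "p \<in> S" "norm p < R" "open N" "p \<in> N"
    and "\<And>q. q \<in> S \<inter> N \<Longrightarrow> F p \<le> F q"
    and "\<And>x. x \<in> N \<Longrightarrow> (F has_derivative (\<lambda>v. g x \<bullet> v)) (at x)"
    and "(g has_derivative G) (at p)"
  shows "\<exists>f. (\<forall>i<n. \<forall>j<n. f i \<bullet> f j = (if i = j then 1 else 0)) \<and>
    0 \<le> (\<Sum>i<n. G (f i) \<bullet> f i) - (g p \<bullet> p) / 2"
proof -
  have "p \<notin> manifold_boundary n S" using boundary assms(2) by auto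
  then have "interior_point n S p"
    using proper assms(1)
    by (auto simp: properly_embedded_def submanifold_with_boundary_def manifold_boundary_def)
  then show ?thesis
    using shrinker_second_variation[OF shrinker assms(1)] assms(3-) by blast
qed

text \<open>At a point of least norm the inequality for \<open>x \<bullet> x\<close>, whose Hessian
  is twice the identity, reads \<open>0 \<le> 2 n - p \<bullet> p\<close>.\<close>

lemma point_in_central_ball:
  assumes "ball 0 R \<inter> S \<noteq> {}"
  shows "\<exists>p\<in>S. p \<bullet> p \<le> 2 * real n"
proof -
  obtain x where x: "x \<in> S" "norm x < R" using assms by auto
  \<comment> \<open>Points of \<open>S\<close> outside this ball have norm greater than
    \<open>norm x\<close>, so the minimum over the compact piece is one over all of
    \<open>S\<close>.\<close>
  have "S \<inter> cball 0 (norm x) \<noteq> {}" using x by auto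
  then obtain p where p: "p \<in> S \<inter> cball 0 (norm x)" "\<And>q. q \<in> S \<inter> cball 0 (norm x) \<Longrightarrow> norm p \<le> norm q"
    using continuous_attains_inf[OF compact_Int[OF compact_cball] _ continuous_on_norm_id]
    by blast
  have min: "p \<bullet> p \<le> q \<bullet> q" if "q \<in> S \<inter> UNIV" for q
  proof -
    have "norm p \<le> norm q"
      using p that by (cases "norm q \<le> norm x") auto
    then show ?thesis by (simp add: norm_le)
  qed
  have "\<exists>f :: nat \<Rightarrow> 'a. (\<forall>i<n. \<forall>j<n. f i \<bullet> f j = (if i = j then 1 else 0)) \<and>
      0 \<le> (\<Sum>i<n. 2 *\<^sub>R f i \<bullet> f i) - (2 *\<^sub>R p \<bullet> p) / 2"
  proof (rule second_variation[where N = UNIV and p = p and F = "\<lambda>x. x \<bullet> x"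
        and g = "(*\<^sub>R) 2" and G = "(*\<^sub>R) 2"])
    show "p \<in> S" "norm p < R" using p(1) x by auto
    show "((\<lambda>x. x \<bullet> x) has_derivative (\<lambda>v. 2 *\<^sub>R x \<bullet> v)) (at x)" for x :: 'a
      by (auto intro!: derivative_eq_intros simp: inner_commute)
    show "((*\<^sub>R) 2 has_derivative (*\<^sub>R) 2) (at p)"
      by (auto intro!: derivative_eq_intros)
  qed (use min in simp_all)
  then have "p \<bullet> p \<le> 2 * real n" by auto
  then show ?thesis using p by blast
qed

text \<open>If \<open>q\<close> were not strictly outside, a multiple of
  \<open>a\<^sup>2 - x \<bullet> x\<close> would touch \<open>2 k - P x \<bullet> P x\<close> from
  below at some \<open>p\<close>. The second variation inequality for their difference then yields
  \<open>a\<^sup>2 \<le> 2 n\<close>.\<close>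

lemma strictly_outside_cylinder:
  assumes P: "linear P" "\<And>x y. P x \<bullet> y = x \<bullet> P y" "\<And>x. P (P x) = P x"
      "(\<Sum>b\<in>Basis. P b \<bullet> P b) = real (k + 1)" and DIM: "DIM('a) = n + 1"
    and a: "2 * real n < a\<^sup>2" "a < R"
    and ne: "\<And>x. x \<in> S \<Longrightarrow> norm x \<le> a \<Longrightarrow> P x \<bullet> P x \<noteq> 2 * real k"
    and q: "q \<in> S" "norm q < a"
  shows "P q \<bullet> P q > 2 * real k"
proof (rule ccontr)
  assume "\<not> P q \<bullet> P q > 2 * real k"
  note dP = linear_imp_has_derivative[OF P(1)]
  have cP: "continuous_on A P" for A
    by (rule linear_continuous_on_compose[OF continuous_on_id P(1)])
  \<comment> \<open>The weak inequality makes \<open>K\<close> closed; since \<open>S\<close> misses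
    the cylinder in this ball, it is strict on \<open>K\<close>.\<close>
  define K where "K = (S \<inter> cball 0 a) \<inter> {x. P x \<bullet> P x \<le> 2 * real k}"
  have "closed {x. P x \<bullet> P x \<le> 2 * real k}"
    by (intro closed_Collect_le continuous_intros cP)
  then have K: "compact K" unfolding K_def by (intro compact_Int_closed compact_Int compact_cball)
  have u: "0 < 2 * real k - P x \<bullet> P x" if "x \<in> K" for x
    using that ne[of x] by (auto simp: K_def)
  have cont: "continuous_on K (\<lambda>x. 2 * real k - P x \<bullet> P x)"
    by (intro continuous_intros cP)
  have qK: "q \<in> K" using q \<open>\<not> _\<close> by (auto simp: K_def)
  obtain p \<mu> where p: "p \<in> K" "norm p < a" "\<mu> > 0"
      "2 * real k - P p \<bullet> P p = \<mu> * (a\<^sup>2 - p \<bullet> p)"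
    and touch: "\<And>x. x \<in> K \<Longrightarrow> \<mu> * (a\<^sup>2 - x \<bullet> x) \<le> 2 * real k - P x \<bullet> P x"
    using touching_paraboloid[OF K cont u qK q(2)] by blast
  \<comment> \<open>An open set containing \<open>p\<close> whose points in \<open>S\<close> belong
    to \<open>K\<close>, so the touching inequality is a local minimum of
    \<open>\<mu> * (x \<bullet> x) - P x \<bullet> P x\<close>.\<close>
  define N where "N = ball 0 a \<inter> {x. P x \<bullet> P x < 2 * real k}"
  have "\<exists>f :: nat \<Rightarrow> 'a. (\<forall>i<n. \<forall>j<n. f i \<bullet> f j = (if i = j then 1 else 0)) \<and>
      0 \<le> (\<Sum>i<n. 2 *\<^sub>R (\<mu> *\<^sub>R f i - P (f i)) \<bullet> f i) - (2 *\<^sub>R (\<mu> *\<^sub>R p - P p) \<bullet> p) / 2"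
  proof (rule second_variation)
    have "open {x. P x \<bullet> P x < 2 * real k}"
      by (intro open_Collect_less continuous_intros cP)
    then show "open N" by (auto simp: N_def)
    show "p \<in> S" "norm p < R" "p \<in> N" using p u[OF p(1)] a by (auto simp: K_def N_def)
    show "\<mu> * (p \<bullet> p) - P p \<bullet> P p \<le> \<mu> * (x \<bullet> x) - P x \<bullet> P x" if "x \<in> S \<inter> N" for x
      using touch[of x] that p(4) by (auto simp: N_def K_def algebra_simps)
    have PP: "P x \<bullet> P y = P x \<bullet> y" for x y using P(2,3) by metis
    show "((\<lambda>x. \<mu> * (x \<bullet> x) - P x \<bullet> P x) has_derivative (\<lambda>v. 2 *\<^sub>R (\<mu> *\<^sub>R x - P x) \<bullet> v)) (at x)" for x
    proof (rule has_derivative_eq_rhs)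
      show "((\<lambda>x. \<mu> * (x \<bullet> x) - P x \<bullet> P x) has_derivative
          (\<lambda>v. \<mu> * (x \<bullet> v + v \<bullet> x) - (P x \<bullet> P v + P v \<bullet> P x))) (at x)"
        by (intro has_derivative_diff has_derivative_mult_right has_derivative_inner
            has_derivative_ident dP)
      show "(\<lambda>v. \<mu> * (x \<bullet> v + v \<bullet> x) - (P x \<bullet> P v + P v \<bullet> P x)) = (\<lambda>v. 2 *\<^sub>R (\<mu> *\<^sub>R x - P x) \<bullet> v)"
      proof
        fix v
        have "P x \<bullet> P v = P x \<bullet> v" "P v \<bullet> P x = P x \<bullet> v" using PP inner_commute by metis+
        then show "\<mu> * (x \<bullet> v + v \<bullet> x) - (P x \<bullet> P v + P v \<bullet> P x) = 2 *\<^sub>R (\<mu> *\<^sub>R x - P x) \<bullet> v"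
          by (simp add: inner_diff_left right_diff_distrib inner_commute[of v x])
      qed
    qed
    show "((\<lambda>x. 2 *\<^sub>R (\<mu> *\<^sub>R x - P x)) has_derivative (\<lambda>v. 2 *\<^sub>R (\<mu> *\<^sub>R v - P v))) (at p)"
      by (auto intro!: derivative_eq_intros dP)
  qed
  then obtain f :: "nat \<Rightarrow> 'a" where f: "\<And>i j. i < n \<Longrightarrow> j < n \<Longrightarrow> f i \<bullet> f j = (if i = j then 1 else 0)"
    and ineq: "0 \<le> (\<Sum>i<n. 2 *\<^sub>R (\<mu> *\<^sub>R f i - P (f i)) \<bullet> f i) - (2 *\<^sub>R (\<mu> *\<^sub>R p - P p) \<bullet> p) / 2"
    by blast
  have PP: "P x \<bullet> x = P x \<bullet> P x" for x using P(2,3) by metis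
  have comp: "(x - P x) \<bullet> (x - P x) = x \<bullet> x - P x \<bullet> P x" for x
    using PP[of x] by (simp add: inner_diff_left inner_diff_right inner_commute)
  \<comment> \<open>The complementary projection has full trace \<open>(n + 1) - (k + 1)\<close>, so
    its trace on the frame is at most \<open>n - k\<close>. Hence \<open>P\<close> has trace at
    least \<open>k\<close> on the frame.\<close>
  have "(\<Sum>i<n. (f i - P (f i)) \<bullet> (f i - P (f i))) \<le> (\<Sum>b\<in>Basis. (b - P b) \<bullet> (b - P b))"
    by (rule orthonormal_trace_le[OF f]) (auto simp: inner_diff_left inner_diff_right P(2))
  then have "real n - (\<Sum>i<n. P (f i) \<bullet> P (f i)) \<le> real n - real k"
    using f P(4) DIM by (simp add: comp sum_subtractf inner_Basis)
  moreover have "(\<Sum>i<n. 2 *\<^sub>R (\<mu> *\<^sub>R f i - P (f i)) \<bullet> f i) = (\<Sum>i<n. 2 * \<mu> - 2 * (P (f i) \<bullet> P (f i)))"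
    using f by (intro sum.cong) (simp_all add: inner_diff_left PP right_diff_distrib)
  moreover have "\<dots> = 2 * \<mu> * real n - 2 * (\<Sum>i<n. P (f i) \<bullet> P (f i))"
    by (simp add: sum_subtractf sum_distrib_left)
  moreover have "(2 *\<^sub>R (\<mu> *\<^sub>R p - P p) \<bullet> p) / 2 = \<mu> * (p \<bullet> p) - P p \<bullet> P p"
    by (simp add: inner_diff_left PP)
  ultimately have "2 * real k - P p \<bullet> P p \<le> 2 * \<mu> * real n - \<mu> * (p \<bullet> p)"
    using ineq by linarith
  \<comment> \<open>The touching equation replaces the left side by
    \<open>\<mu> * (a\<^sup>2 - p \<bullet> p)\<close>, and the terms in
    \<open>p \<bullet> p\<close> cancel.\<close>
  then have "\<mu> * a\<^sup>2 \<le> \<mu> * (2 * real n)"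
    using p(4) by (simp add: right_diff_distrib mult_ac)
  then show False using a p(3) by simp
qed

text \<open>The same touching argument from the other side, with \<open>norm (P x)\<close> in place
  of its square: the Hessian of the norm vanishes in the radial direction, so its trace involves
  \<open>k\<close> and not \<open>k + 1\<close>.\<close>

lemma strictly_inside_cylinder:
  assumes P: "linear P" "\<And>x y. P x \<bullet> y = x \<bullet> P y" "\<And>x. P (P x) = P x"
      "(\<Sum>b\<in>Basis. P b \<bullet> P b) = real (k + 1)"
    and a: "4 * real n < a\<^sup>2" "a < R"
    and ne: "\<And>x. x \<in> S \<Longrightarrow> norm x \<le> a \<Longrightarrow> norm (P x) \<noteq> sqrt (2 * real k)"
    and q: "q \<in> S" "norm q < a"
  shows "norm (P q) < sqrt (2 * real k)"
proof (rule ccontr)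
  define s where "s = sqrt (2 * real k)"
  have s: "0 \<le> s" "s\<^sup>2 = 2 * real k" by (simp_all add: s_def)
  assume "\<not> norm (P q) < sqrt (2 * real k)"
  note dP = linear_imp_has_derivative[OF P(1)]
  have cP: "continuous_on A P" for A
    by (rule linear_continuous_on_compose[OF continuous_on_id P(1)])
  define K where "K = (S \<inter> cball 0 a) \<inter> {x. s \<le> norm (P x)}"
  have "closed {x. s \<le> norm (P x)}"
    by (intro closed_Collect_le continuous_intros cP)
  then have K: "compact K" unfolding K_def by (intro compact_Int_closed compact_Int compact_cball)
  have u: "0 < norm (P x) - s" if "x \<in> K" for x
    using that ne[of x] by (auto simp: K_def s_def)
  have cont: "continuous_on K (\<lambda>x. norm (P x) - s)"
    by (intro continuous_intros cP)
  have qK: "q \<in> K" using q \<open>\<not> _\<close> by (auto simp: K_def s_def)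
  obtain p \<mu> where p: "p \<in> K" "norm p < a" "\<mu> > 0"
      "norm (P p) - s = \<mu> * (a\<^sup>2 - p \<bullet> p)"
    and touch: "\<And>x. x \<in> K \<Longrightarrow> \<mu> * (a\<^sup>2 - x \<bullet> x) \<le> norm (P x) - s"
    using touching_paraboloid[OF K cont u qK q(2)] by blast
  define N where "N = ball 0 a \<inter> {x. s < norm (P x)}"
  define r where "r = norm (P p)"
  \<comment> \<open>Strict positivity of \<open>r\<close> holds even for \<open>k = 0\<close>, where
    \<open>s = 0\<close>; it keeps the norm differentiable at \<open>P p\<close>.\<close>
  have r: "s < r" "0 < r" using u[OF p(1)] s(1) by (auto simp: r_def)
  have rr: "P p \<bullet> P p = r\<^sup>2" by (simp add: r_def power2_norm_eq_inner)
  define e where "e = P p /\<^sub>R r"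
  have PP: "P x \<bullet> P y = P x \<bullet> y" for x y using P(2,3) by metis
  have ee: "e \<bullet> e = 1" "P e = e"
    using rr r(2) linear_scale[OF P(1)] P(3) by (simp_all add: e_def power2_eq_square field_simps)
  have "\<exists>f :: nat \<Rightarrow> 'a. (\<forall>i<n. \<forall>j<n. f i \<bullet> f j = (if i = j then 1 else 0)) \<and>
      0 \<le> (\<Sum>i<n. ((P (f i) - (e \<bullet> f i) *\<^sub>R e) /\<^sub>R r + (2 * \<mu>) *\<^sub>R f i) \<bullet> f i) -
        ((P p /\<^sub>R norm (P p) + (2 * \<mu>) *\<^sub>R p) \<bullet> p) / 2"
  proof (rule second_variation)
    have "open {x. s < norm (P x)}"
      by (intro open_Collect_less continuous_intros cP)
    then show "open N" by (auto simp: N_def)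
    show "p \<in> S" "norm p < R" "p \<in> N" using p u[OF p(1)] a by (auto simp: K_def N_def)
    show "norm (P p) + \<mu> * (p \<bullet> p) \<le> norm (P x) + \<mu> * (x \<bullet> x)" if "x \<in> S \<inter> N" for x
      using touch[of x] that p(4) by (auto simp: N_def K_def algebra_simps)
    have dn: "((\<lambda>x. norm (P x)) has_derivative (\<lambda>v. (P x /\<^sub>R norm (P x)) \<bullet> v)) (at x)"
      if "P x \<noteq> 0" for x
    proof -
      have "((\<lambda>x. norm (P x)) has_derivative (\<lambda>v. sgn (P x) \<bullet> P v)) (at x)"
        using has_derivative_compose[OF dP has_derivative_norm[OF that]] by (simp add: inner_commute)
      then show ?thesis
        by (rule has_derivative_eq_rhs) (simp add: sgn_div_norm PP)
    qed
    show "((\<lambda>x. norm (P x) + \<mu> * (x \<bullet> x)) has_derivative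
        (\<lambda>v. (P x /\<^sub>R norm (P x) + (2 * \<mu>) *\<^sub>R x) \<bullet> v)) (at x)" if "x \<in> N" for x
    proof -
      have "P x \<noteq> 0" using that s(1) by (auto simp: N_def)
      then show ?thesis
        by (auto intro!: derivative_eq_intros dn simp: inner_add_left inner_add_right inner_commute)
    qed
    have Pp0: "P p \<noteq> 0" using r by (auto simp: r_def)
    \<comment> \<open>The gradient contains the unit field \<open>P x / norm (P x)\<close>; its
      derivative at \<open>p\<close> comes from the product rule and is the projection orthogonal to
      \<open>e\<close>, divided by \<open>r\<close>.\<close>
    have 1: "((\<lambda>x. inverse (norm (P x))) has_derivative (\<lambda>v. - (inverse r * (e \<bullet> v) * inverse r))) (at p)"
      using Deriv.has_derivative_inverse[OF _ dn[OF Pp0]] Pp0 by (simp add: r_def e_def)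
    have 2: "((\<lambda>x. (2 * \<mu>) *\<^sub>R x) has_derivative (\<lambda>v. (2 * \<mu>) *\<^sub>R v)) (at p)"
      by (intro has_derivative_scaleR_right has_derivative_ident)
    show "((\<lambda>x. P x /\<^sub>R norm (P x) + (2 * \<mu>) *\<^sub>R x) has_derivative
        (\<lambda>v. (P v - (e \<bullet> v) *\<^sub>R e) /\<^sub>R r + (2 * \<mu>) *\<^sub>R v)) (at p)"
      by (rule has_derivative_eq_rhs[OF has_derivative_add[OF has_derivative_scaleR[OF 1 dP] 2]])
        (auto simp: fun_eq_iff e_def r_def[symmetric] scaleR_diff_right mult_ac)
  qed
  then obtain f :: "nat \<Rightarrow> 'a" where f: "\<And>i j. i < n \<Longrightarrow> j < n \<Longrightarrow> f i \<bullet> f j = (if i = j then 1 else 0)"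
    and ineq: "0 \<le> (\<Sum>i<n. ((P (f i) - (e \<bullet> f i) *\<^sub>R e) /\<^sub>R r + (2 * \<mu>) *\<^sub>R f i) \<bullet> f i) -
        ((P p /\<^sub>R norm (P p) + (2 * \<mu>) *\<^sub>R p) \<bullet> p) / 2"
    by blast
  \<comment> \<open>The orthogonal projection onto the part of the range of \<open>P\<close>
    orthogonal to \<open>e\<close>; its trace is \<open>(k + 1) - 1\<close>.\<close>
  define Q where "Q = (\<lambda>x. P x - (e \<bullet> x) *\<^sub>R e)"
  have QQ: "Q x \<bullet> Q x = P x \<bullet> P x - (e \<bullet> x)\<^sup>2" "Q x \<bullet> x = Q x \<bullet> Q x" for x
  proof -
    have *: "P x \<bullet> e = e \<bullet> x" using P(2) ee(2) by (metis inner_commute)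
    show "Q x \<bullet> Q x = P x \<bullet> P x - (e \<bullet> x)\<^sup>2" "Q x \<bullet> x = Q x \<bullet> Q x"
      using ee(1) * PP[of x x]
      by (simp_all add: Q_def inner_diff_left inner_diff_right inner_commute[of e "P x"] power2_eq_square)
  qed
  have "(\<Sum>i<n. Q (f i) \<bullet> Q (f i)) \<le> (\<Sum>b\<in>Basis. Q b \<bullet> Q b)"
    by (rule orthonormal_trace_le[OF f]) (simp_all add: Q_def inner_diff_left inner_diff_right P(2) inner_commute[of _ e])
  also have "\<dots> = real (k + 1) - e \<bullet> e"
    unfolding QQ(1) sum_subtractf P(4) euclidean_inner[of e e] by (simp add: power2_eq_square)
  finally have trace: "(\<Sum>i<n. Q (f i) \<bullet> Q (f i)) \<le> real k" using ee(1) by simp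
  have Pp: "P p \<bullet> p = r\<^sup>2" using rr PP[of p p] by simp
  have Qx: "P x - (e \<bullet> x) *\<^sub>R e = Q x" for x by (simp add: Q_def)
  have "(\<Sum>i<n. ((P (f i) - (e \<bullet> f i) *\<^sub>R e) /\<^sub>R r + (2 * \<mu>) *\<^sub>R f i) \<bullet> f i) =
      (\<Sum>i<n. (Q (f i) \<bullet> Q (f i)) / r + 2 * \<mu>)"
    using f by (intro sum.cong refl)
      (simp add: Qx inner_add_left QQ(2) divide_inverse mult.commute)
  moreover have "\<dots> = (\<Sum>i<n. Q (f i) \<bullet> Q (f i)) / r + 2 * \<mu> * real n"
    by (simp add: sum.distrib sum_divide_distrib)
  moreover have "((P p /\<^sub>R norm (P p) + (2 * \<mu>) *\<^sub>R p) \<bullet> p) / 2 = r / 2 + \<mu> * (p \<bullet> p)"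
    using r(2) by (simp add: inner_add_left Pp r_def[symmetric] power2_eq_square field_simps)
  moreover have "(\<Sum>i<n. Q (f i) \<bullet> Q (f i)) / r \<le> real k / r"
    using trace r(2) by (intro divide_right_mono) auto
  \<comment> \<open>Since \<open>2 k = s\<^sup>2\<close>, the quotient is
    \<open>(s / 2) * (s / r)\<close>, and \<open>s < r\<close>.\<close>
  moreover have "real k / r \<le> s / 2"
  proof -
    have "s * s \<le> s * r" using r s by (intro mult_left_mono) auto
    then show ?thesis using s r by (simp add: field_simps power2_eq_square)
  qed
  ultimately have "r / 2 + \<mu> * (p \<bullet> p) \<le> s / 2 + 2 * \<mu> * real n"
    using ineq by linarith
  \<comment> \<open>Substituting the touching equation and doubling leaves
    \<open>a\<^sup>2 + p \<bullet> p\<close> on the left, which is the source of the bound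
    \<open>4 n\<close>.\<close>
  then have "\<mu> * (a\<^sup>2 + p \<bullet> p) \<le> \<mu> * (4 * real n)"
    using p(4) by (simp add: r_def[symmetric] algebra_simps)
  then have "a\<^sup>2 + p \<bullet> p \<le> 4 * real n" using p(3) by simp
  then show False using a(1) inner_ge_zero[of p] by linarith
qed

text \<open>If \<open>S\<close> missed the cylinder in the closed ball of radius \<open>a\<close>, a
  point of least norm, which lies in the open ball, would be strictly on both sides of it.\<close>

lemma meets_generalized_cylinder:
  assumes W: "subspace W" "dim W = k + 1" and DIM: "DIM('a) = n + 1"
    and a: "4 * real n < a\<^sup>2" "0 < a" "a < R" and "ball 0 R \<inter> S \<noteq> {}"
  shows "\<exists>x \<in> S \<inter> generalized_cylinder k W. norm x \<le> a"
proof (rule ccontr)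
  assume contra: "\<not> ?thesis"
  show False
  proof (rule orthogonal_projection_exists[OF W(1)])
    fix P assume P: "linear P" "\<And>x. P x \<in> W" "\<And>x. x - P x \<in> orthogonal_comp W"
      "\<And>x y. P x \<bullet> y = x \<bullet> P y" "\<And>x. P (P x) = P x" "(\<Sum>b\<in>Basis. P b \<bullet> P b) = real (dim W)"
    note trace = P(6)[unfolded W(2)]
    have ne: "norm (P x) \<noteq> sqrt (2 * real k)" if "x \<in> S" "norm x \<le> a" for x
      using contra that mem_generalized_cylinder[of P x W k] P(2,3) by blast
    have iff: "norm x = sqrt c \<longleftrightarrow> x \<bullet> x = c" "norm x < sqrt c \<longleftrightarrow> x \<bullet> x < c" for x :: 'a and c
      by (simp_all add: norm_eq_sqrt_inner)
    obtain q where q: "q \<in> S" "q \<bullet> q \<le> 2 * real n" using point_in_central_ball assms by blast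
    have "norm q < a"
    proof (rule power2_less_imp_less)
      show "(norm q)\<^sup>2 < a\<^sup>2" using q a by (simp add: power2_norm_eq_inner)
    qed (use a in simp)
    have "norm (P q) < sqrt (2 * real k)"
      using strictly_inside_cylinder[OF P(1,4,5) trace a(1,3) ne q(1) \<open>norm q < a\<close>] by simp
    moreover have "2 * real k < P q \<bullet> P q"
    proof (rule strictly_outside_cylinder[OF P(1,4,5) trace DIM _ a(3) _ q(1) \<open>norm q < a\<close>])
      show "2 * real n < a\<^sup>2" using a(1) by linarith
      show "P x \<bullet> P x \<noteq> 2 * real k" if "x \<in> S" "norm x \<le> a" for x
        using ne[OF that] iff by blast
    qed
    ultimately show False using iff by force
  qed
qed

end

section \<open>Choice of the constant\<close>

theorem corollary1p5:
  fixes n :: nat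
  assumes "n \<ge> 1" and "CARD('m::finite) = n + 1"
  shows "\<exists>Rn::real. Rn > 0 \<and>
    (\<forall>(S :: (real ^ 'm) set) (R::real).
       properly_embedded n S \<and> shrinker n S \<and> R \<ge> Rn \<and>
       manifold_boundary n S \<subseteq> sphere 0 R \<and> ball 0 R \<inter> S \<noteq> {} \<longrightarrow>
       (\<forall>k\<le>n. \<forall>W :: (real ^ 'm) set. subspace W \<and> dim W = k + 1 \<longrightarrow>
          ball 0 Rn \<inter> S \<inter> generalized_cylinder k W \<noteq> {}))"
proof -
  \<comment> \<open>Any positive \<open>a\<close> with \<open>a\<^sup>2 > 4 n\<close> would do; here
    \<open>a\<^sup>2 = 4 n + 4 sqrt n + 1\<close>.\<close>
  define a where "a = 2 * sqrt (real n) + 1"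
  have a: "0 < a" "4 * real n < a\<^sup>2"
  proof -
    show "0 < a" by (simp add: a_def add_nonneg_pos)
    have "a\<^sup>2 = 4 * real n + 4 * sqrt (real n) + 1"
      by (simp add: a_def power2_sum power_mult_distrib)
    then show "4 * real n < a\<^sup>2" using real_sqrt_ge_zero[of "real n"] by linarith
  qed
  show ?thesis
  \<comment> \<open>The extra 1 gives \<open>a < R\<close> whenever \<open>R \<ge> a + 1\<close>,
    and places the closed ball of radius \<open>a\<close> inside the open ball of the
    theorem.\<close>
  proof (intro exI[of _ "a + 1"] conjI allI impI)
    fix S :: "(real ^ 'm) set" and R k and W :: "(real ^ 'm) set"
    assume S: "properly_embedded n S \<and> shrinker n S \<and> a + 1 \<le> R \<and>
      manifold_boundary n S \<subseteq> sphere 0 R \<and> ball 0 R \<inter> S \<noteq> {}"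
      and W: "subspace W \<and> dim W = k + 1"
    interpret embedded_shrinker n S R using S by unfold_locales auto
    have "\<exists>x \<in> S \<inter> generalized_cylinder k W. norm x \<le> a"
      using S W a assms(2) by (intro meets_generalized_cylinder) auto
    then obtain x where "x \<in> S" "x \<in> generalized_cylinder k W" "norm x \<le> a" by blast
    then have "x \<in> ball 0 (a + 1) \<inter> S \<inter> generalized_cylinder k W" by simp
    then show "ball 0 (a + 1) \<inter> S \<inter> generalized_cylinder k W \<noteq> {}" by blast
  qed (use a in simp)
qed

end
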